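(* For $p\in V_{\mathbb Q}$ let $e^{(p)}=\phi^{(p)}\in L^2(\mathbb Q_p,dx_p)$, where $\phi^{(p)}(x_p)=\Omega(|x_p|_p)$ for primes $p$ and $\phi^{(\infty)}=\chi_{[0,1]}$, and let $e=(e^{(p)})_{p\in V_{\mathbb Q}}$. Then $$L^2(\mathbb A,dx)=\bigotimes_{e,\,p\in V_{\mathbb Q}}L^2(\mathbb Q_p,dx_p),$$ i.e. the correspondence sending a vector $\bigotimes_{p}f_p$ (with $f_p\in L^2(\mathbb Q_p,dx_p)$ for all $p$ and $f_p=e^{(p)}$ for all but finitely many $p$) to the function $x=(x_p)_p\mapsto\prod_{p}f_p(x_p)$ on $\mathbb A$ extends to a unitary isomorphism from the infinite tensor product with stabilizing sequence $e$ onto $L^2(\mathbb A,dx)$.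
   Context: $V_{\mathbb Q}=\{\infty,2,3,5,\dots\}$ is the set consisting of $\infty$ and all primes; $\mathbb Q_\infty=\mathbb R$, $|\cdot|_\infty$ is the usual absolute value. For a prime $p$, $\mathbb Q_p$ is the field of $p$-adic numbers with norm $|\cdot|_p$ and $\mathbb Z_p=\{x\in\mathbb Q_p:|x|_p\le1\}$. $\Omega$ is the characteristic function of $[0,1]\subset\mathbb R$, $\chi_{[0,1]}$ the same function on $\mathbb R$. $dx_p$ is Haar measure on $\mathbb Q_p$ with $\int_{\mathbb Z_p}dx_p=1$, $dx_\infty$ is Lebesgue measure. The adele ring $\mathbb A$ is the set of $(x_p)_{p\in V_{\mathbb Q}}\in\prod_p\mathbb Q_p$ with $x_p\in\mathbb Z_p$ for all but finitely many primes $p$, with the restricted product topology; $dx$ is the Haar measure on $\mathbb A$ given by $dx=dx_\infty\,dx_2\,dx_3\cdots$ (so $[0,1]\times\prod_{p}\mathbb Z_p$ has measure $1$). Infinite tensor product: given separable Hilbert spaces $H_n$ ($n$ in a countable set) and unit vectors $e^{(n)}\in H_n$ (the stabilizing sequence $e$), choose an orthonormal basis $(e^{(n)}_k)_{k}$ of each $H_n$ containing $e^{(n)}$. $\bigotimes_{e,n}H_n$ is the Hilbert space with orthonormal basis consisting of all formal products $\bigotimes_n e^{(n)}_{\alpha_n}$ with $e^{(n)}_{\alpha_n}=e^{(n)}$ for all but finitely many $n$; vectors $\bigotimes_n f_n$ with $f_n=e^{(n)}$ for almost all $n$ are defined by multilinearity and continuity. *)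

theory Defs
  imports
    "HOL-Analysis.Analysis"
    "HOL-Algebra.QuotRing"
    "HOL-Algebra.Weak_Morphisms"
    "HOL-Computational_Algebra.Primes"
begin

section \<open>The completions of the rationals\<close>

subsection \<open>The field of p-adic numbers\<close>

definition padic_abs :: "nat \<Rightarrow> rat \<Rightarrow> real" where
  "padic_abs p x =
     (if x = 0 then 0
      else real p powi (int (multiplicity (int p) (snd (quotient_of x)))
                        - int (multiplicity (int p) (fst (quotient_of x)))))"

definition padic_cauchy_ring :: "nat \<Rightarrow> (nat \<Rightarrow> rat) ring" where
  "padic_cauchy_ring p =
     \<lparr>carrier = {X. Metric_space.MCauchy UNIV (\<lambda>x y. padic_abs p (x - y)) X},
      mult = (\<lambda>X Y n. X n * Y n), one = (\<lambda>_. 1),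
      zero = (\<lambda>_. 0), add = (\<lambda>X Y n. X n + Y n)\<rparr>"

definition padic_null_ideal :: "nat \<Rightarrow> (nat \<Rightarrow> rat) set" where
  "padic_null_ideal p =
     {X \<in> carrier (padic_cauchy_ring p). (\<lambda>n. padic_abs p (X n)) \<longlonglongrightarrow> 0}"

definition padic_field :: "nat \<Rightarrow> (nat \<Rightarrow> rat) set ring" where
  "padic_field p = padic_cauchy_ring p Quot padic_null_ideal p"

definition padic_norm :: "nat \<Rightarrow> (nat \<Rightarrow> rat) set \<Rightarrow> real" where
  "padic_norm p a = (THE r. \<exists>X\<in>a. (\<lambda>n. padic_abs p (X n)) \<longlonglongrightarrow> r)"

subsection \<open>All places at once\<close>

datatype place = Inf_place | Prime_place nat

definition VQ :: "place set" where
  "VQ = insert Inf_place (Prime_place ` {p. prime p})"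

text \<open>
  Elements of all the completions live in one type, so that families indexed by places can be
  formed: the left summand carries the real numbers, the right summand carries the p-adic
  numbers for every p.
\<close>

type_synonym loc = "real + (nat \<Rightarrow> rat) set"

definition real_field :: "real ring" where
  "real_field = \<lparr>carrier = UNIV, mult = (*), one = 1, zero = 0, add = (+)\<rparr>"

fun local_field :: "place \<Rightarrow> loc ring" where
  "local_field Inf_place = image_ring Inl real_field"
| "local_field (Prime_place p) = image_ring Inr (padic_field p)"

fun local_abs :: "place \<Rightarrow> loc \<Rightarrow> real" where
  "local_abs Inf_place x = \<bar>projl x\<bar>"
| "local_abs (Prime_place p) x = padic_norm p (projr x)"

definition local_topology :: "place \<Rightarrow> loc topology" where
  "local_topology v =
     Metric_space.mtopology (carrier (local_field v))
       (\<lambda>x y. local_abs v (x \<ominus>\<^bsub>local_field v\<^esub> y))"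

definition local_integers :: "nat \<Rightarrow> loc set" where
  "local_integers p =
     {x \<in> carrier (local_field (Prime_place p)). local_abs (Prime_place p) x \<le> 1}"

section \<open>The adele ring\<close>

definition adele_ring :: "(place \<Rightarrow> loc) ring" where
  "adele_ring =
     \<lparr>carrier = {x \<in> (\<Pi>\<^sub>E v\<in>VQ. carrier (local_field v)).
                   finite {p. prime p \<and> x (Prime_place p) \<notin> local_integers p}},
      mult = (\<lambda>x y. \<lambda>v\<in>VQ. x v \<otimes>\<^bsub>local_field v\<^esub> y v),
      one = (\<lambda>v\<in>VQ. \<one>\<^bsub>local_field v\<^esub>),
      zero = (\<lambda>v\<in>VQ. \<zero>\<^bsub>local_field v\<^esub>),
      add = (\<lambda>x y. \<lambda>v\<in>VQ. x v \<oplus>\<^bsub>local_field v\<^esub> y v)\<rparr>"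

definition adele_topology :: "(place \<Rightarrow> loc) topology" where
  "adele_topology = topology_generated_by
     {\<Pi>\<^sub>E v\<in>VQ. U v | U. (\<forall>v\<in>VQ. openin (local_topology v) (U v)) \<and>
                       finite {p. prime p \<and> U (Prime_place p) \<noteq> local_integers p}}"

section \<open>Haar measures\<close>

text \<open>Haar measure for the additive group of a ring, on its Borel sets, as a nonzero
  translation-invariant Radon measure.\<close>

definition haar_measure :: "('a, 'm) ring_scheme \<Rightarrow> 'a topology \<Rightarrow> 'a measure \<Rightarrow> bool" where
  "haar_measure R T M \<longleftrightarrow>
     space M = carrier R \<and>
     sets M = sigma_sets (carrier R) {U. openin T U} \<and>
     (\<forall>A\<in>sets M. \<forall>g\<in>carrier R. emeasure M ((\<lambda>x. g \<oplus>\<^bsub>R\<^esub> x) ` A) = emeasure M A) \<and>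
     emeasure M (space M) \<noteq> 0 \<and>
     (\<forall>K. compactin T K \<longrightarrow> emeasure M K < \<infinity>) \<and>
     (\<forall>A\<in>sets M. emeasure M A = (INF U\<in>{U. openin T U \<and> A \<subseteq> U}. emeasure M U)) \<and>
     (\<forall>U. openin T U \<longrightarrow> emeasure M U = (SUP K\<in>{K. compactin T K \<and> K \<subseteq> U}. emeasure M K))"

text \<open>The identity $dx = dx_\infty\,dx_2\,dx_3\cdots$: the measure of a rectangle with finitely many
  arbitrary factors, the one at infinity included, all others being rings of integers.\<close>

definition adele_rectangle :: "place set \<Rightarrow> (place \<Rightarrow> loc set) \<Rightarrow> (place \<Rightarrow> loc) set" where
  "adele_rectangle S A =
     {x \<in> (\<Pi>\<^sub>E v\<in>VQ. carrier (local_field v)).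
        (\<forall>v\<in>S. x v \<in> A v) \<and>
        (\<forall>p. prime p \<and> Prime_place p \<notin> S \<longrightarrow> x (Prime_place p) \<in> local_integers p)}"

definition adele_product_measure ::
    "(place \<Rightarrow> loc measure) \<Rightarrow> (place \<Rightarrow> loc) measure \<Rightarrow> bool" where
  "adele_product_measure dx M \<longleftrightarrow>
     (\<forall>S A. finite S \<and> Inf_place \<in> S \<and> S \<subseteq> VQ \<and> (\<forall>v\<in>S. A v \<in> sets (dx v)) \<longrightarrow>
        emeasure M (adele_rectangle S A) = (\<Prod>v\<in>S. emeasure (dx v) (A v)))"

section \<open>Complex Hilbert spaces\<close>

record 'a hilbert =
  hcarrier :: "'a set"
  hzero :: 'a
  hadd :: "'a \<Rightarrow> 'a \<Rightarrow> 'a"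
  hscale :: "complex \<Rightarrow> 'a \<Rightarrow> 'a"
  hinner :: "'a \<Rightarrow> 'a \<Rightarrow> complex"  \<comment> \<open>linear in the first argument\<close>

definition hdist :: "'a hilbert \<Rightarrow> 'a \<Rightarrow> 'a \<Rightarrow> real" where
  "hdist H x y = (let d = hadd H x (hscale H (- 1) y) in sqrt (Re (hinner H d d)))"

inductive_set hspan :: "'a hilbert \<Rightarrow> 'a set \<Rightarrow> 'a set" for H B where
  zero: "hzero H \<in> hspan H B"
| step: "x \<in> hspan H B \<Longrightarrow> b \<in> B \<Longrightarrow> hadd H x (hscale H c b) \<in> hspan H B"

definition orthonormal_basis :: "'a hilbert \<Rightarrow> 'a set \<Rightarrow> bool" where
  "orthonormal_basis H B \<longleftrightarrow>
     B \<subseteq> hcarrier H \<and>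
     (\<forall>a\<in>B. \<forall>b\<in>B. hinner H a b = (if a = b then 1 else 0)) \<and>
     (\<forall>x\<in>hcarrier H. \<forall>\<epsilon>>0. \<exists>y\<in>hspan H B. hdist H x y < \<epsilon>)"

definition unitary_iso :: "'a hilbert \<Rightarrow> 'b hilbert \<Rightarrow> ('a \<Rightarrow> 'b) \<Rightarrow> bool" where
  "unitary_iso H K U \<longleftrightarrow>
     bij_betw U (hcarrier H) (hcarrier K) \<and>
     (\<forall>x\<in>hcarrier H. \<forall>y\<in>hcarrier H. U (hadd H x y) = hadd K (U x) (U y)) \<and>
     (\<forall>c. \<forall>x\<in>hcarrier H. U (hscale H c x) = hscale K c (U x)) \<and>
     (\<forall>x\<in>hcarrier H. \<forall>y\<in>hcarrier H. hinner K (U x) (U y) = hinner H x y)"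

subsection \<open>Square-integrable functions modulo equality almost everywhere\<close>

definition square_integrable :: "'x measure \<Rightarrow> ('x \<Rightarrow> complex) \<Rightarrow> bool" where
  "square_integrable M f \<longleftrightarrow>
     f \<in> borel_measurable M \<and> integrable M (\<lambda>x. (cmod (f x))\<^sup>2)"

definition L2_class :: "'x measure \<Rightarrow> ('x \<Rightarrow> complex) \<Rightarrow> ('x \<Rightarrow> complex) set" where
  "L2_class M f = {g \<in> borel_measurable M. AE x in M. g x = f x}"

definition L2_rep :: "('x \<Rightarrow> complex) set \<Rightarrow> 'x \<Rightarrow> complex" where
  "L2_rep F = (SOME f. f \<in> F)"

definition L2 :: "'x measure \<Rightarrow> ('x \<Rightarrow> complex) set hilbert" where
  "L2 M =
     \<lparr>hcarrier = L2_class M ` {f. square_integrable M f},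
      hzero = L2_class M (\<lambda>_. 0),
      hadd = (\<lambda>F G. L2_class M (\<lambda>x. L2_rep F x + L2_rep G x)),
      hscale = (\<lambda>c F. L2_class M (\<lambda>x. c * L2_rep F x)),
      hinner = (\<lambda>F G. \<integral>x. L2_rep F x * cnj (L2_rep G x) \<partial>M)\<rparr>"

section \<open>Infinite tensor products\<close>

text \<open>The index set of the orthonormal basis of formal products; \<open>B i\<close> is the chosen orthonormal
  basis of the factor \<open>i\<close>, and \<open>e\<close> is the stabilizing sequence. The Hilbert space with this
  orthonormal basis is taken to be the space of square-summable coordinate families.\<close>

definition tensor_index :: "'i set \<Rightarrow> ('i \<Rightarrow> 'a set) \<Rightarrow> ('i \<Rightarrow> 'a) \<Rightarrow> ('i \<Rightarrow> 'a) set" where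
  "tensor_index I B e = {\<alpha> \<in> (\<Pi>\<^sub>E i\<in>I. B i). finite {i \<in> I. \<alpha> i \<noteq> e i}}"

definition infinite_tensor ::
    "'i set \<Rightarrow> ('i \<Rightarrow> 'a set) \<Rightarrow> ('i \<Rightarrow> 'a) \<Rightarrow> (('i \<Rightarrow> 'a) \<Rightarrow> complex) set hilbert" where
  "infinite_tensor I B e = L2 (count_space (tensor_index I B e))"

text \<open>The vector $\bigotimes_i f_i$, where $f_i = e_i$ for almost all $i$. Expanding each $f_i$ in the
  basis \<open>B i\<close>, multilinearity and continuity give the coordinate
  $\prod_i \langle f_i, \alpha_i\rangle$ at the basis vector $\bigotimes_i \alpha_i$. All but finitely
  many factors of that product are $\langle e_i, e_i\rangle = 1$; these are left out, as \<open>prod\<close>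
  needs a finite index set.\<close>

definition tensor_vector ::
    "'i set \<Rightarrow> ('i \<Rightarrow> 'a hilbert) \<Rightarrow> ('i \<Rightarrow> 'a set) \<Rightarrow> ('i \<Rightarrow> 'a) \<Rightarrow> ('i \<Rightarrow> 'a)
       \<Rightarrow> (('i \<Rightarrow> 'a) \<Rightarrow> complex) set" where
  "tensor_vector I H B e f =
     L2_class (count_space (tensor_index I B e))
       (\<lambda>\<alpha>. \<Prod>i\<in>{i \<in> I. f i \<noteq> e i \<or> \<alpha> i \<noteq> e i}. hinner (H i) (f i) (\<alpha> i))"

section \<open>The stabilizing sequence and products of local functions\<close>

fun vacuum :: "place \<Rightarrow> loc \<Rightarrow> complex" where
  "vacuum Inf_place x = indicator {0..1} (projl x)"
| "vacuum (Prime_place p) x = indicator {0..1} (local_abs (Prime_place p) x)"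

text \<open>The product over all places, whose factors different from 1 are finitely many whenever
  \<open>x\<close> is an adele and \<open>f v\<close> is the function \<open>vacuum v\<close> for almost all \<open>v\<close>.\<close>

definition adele_product :: "(place \<Rightarrow> loc \<Rightarrow> complex) \<Rightarrow> (place \<Rightarrow> loc) \<Rightarrow> complex" where
  "adele_product f x = (\<Prod>v\<in>{v \<in> VQ. f v (x v) \<noteq> 1}. f v (x v))"

end

theory Submission
  imports Defs
begin

text \<open>
  The products of basis vectors form an orthonormal family in the square-integrable functions on the
  adeles, since on a set of adeles integral outside a finite set \<open>S\<close> of places the adelic measure is
  a finite product measure. Its coefficient map is an isometry onto the square-summable families, by
  Parseval and Riesz--Fischer, as soon as the family is total. Totality: a function orthogonal to all
  products of basis vectors is orthogonal to all products of square-integrable functions, hence to the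
  indicators of rectangles; basic open sets are rectangles, so inner regularity of open sets (compact
  sets are covered by finitely many basic open sets) and outer regularity of Borel sets show that it
  is orthogonal to all indicators of sets of finite measure, hence zero.
\<close>

section \<open>Square-integrable functions\<close>

text \<open>The obstacle is the lack of countability on the topological side:
  \<open>haar_measure\<close> describes Radon measures and says nothing of sigma-finiteness or a
  countable base. An open set of adeles may be an uncountable union of basic ones, so a monotone
  class argument starting from rectangles does not reach every Borel set; regularity takes its
  place, compact sets supplying finite subcovers. Product measures, in turn, want sigma-finite
  factors; each product is therefore integrated over the supports of its integrable factors, where
  sigma-finiteness is automatic. The index set of the formal products is not shown to be countable
  either, so sums over it are controlled through finite partial sums. A second obstacle is that
  vectors are classes modulo null sets, while \<open>adele_product\<close> involves infinitely many
  values: altering every factor on a null set could ruin the product. At almost all places the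
  literal function \<open>vacuum\<close> is kept, and identities between products are proved at
  every adele.\<close>

definition ip :: "'x measure \<Rightarrow> ('x \<Rightarrow> complex) \<Rightarrow> ('x \<Rightarrow> complex) \<Rightarrow> complex" where
  "ip M f g = (\<integral>x. f x * cnj (g x) \<partial>M)"

definition nsq :: "'x measure \<Rightarrow> ('x \<Rightarrow> complex) \<Rightarrow> real" where
  "nsq M f = (\<integral>x. (cmod (f x))\<^sup>2 \<partial>M)"

lemma cnj_borel_measurable [measurable]: "cnj \<in> borel_measurable borel"
  by (intro borel_measurable_continuous_onI continuous_intros)

lemma square_integrable_zero [simp]: "square_integrable M (\<lambda>_. 0)"
  by (simp add: square_integrable_def)

lemma cmod_add_square_le: "(cmod (a + b))\<^sup>2 \<le> 2 * (cmod a)\<^sup>2 + 2 * (cmod b)\<^sup>2"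
proof -
  have "(cmod (a + b))\<^sup>2 \<le> (cmod a + cmod b)\<^sup>2"
    by (intro power_mono norm_triangle_ineq) auto
  also have "\<dots> \<le> 2 * (cmod a)\<^sup>2 + 2 * (cmod b)\<^sup>2"
    using zero_le_power2[of "cmod a - cmod b"] by (simp add: power2_eq_square algebra_simps)
  finally show ?thesis .
qed

lemma square_integrable_add:
  assumes "square_integrable M f" "square_integrable M g"
  shows "square_integrable M (\<lambda>x. f x + g x)"
proof -
  have [measurable]: "f \<in> borel_measurable M" "g \<in> borel_measurable M"
    using assms by (auto simp: square_integrable_def)
  have "integrable M (\<lambda>x. 2 * (cmod (f x))\<^sup>2 + 2 * (cmod (g x))\<^sup>2)"
    using assms by (auto simp: square_integrable_def)
  then have "integrable M (\<lambda>x. (cmod (f x + g x))\<^sup>2)"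
    by (rule Bochner_Integration.integrable_bound) (use cmod_add_square_le in auto)
  then show ?thesis by (auto simp: square_integrable_def)
qed

lemma square_integrable_scale:
  assumes "square_integrable M f"
  shows "square_integrable M (\<lambda>x. c * f x)"
  using assms by (auto simp: square_integrable_def norm_mult power_mult_distrib)

lemma square_integrable_diff:
  assumes "square_integrable M f" "square_integrable M g"
  shows "square_integrable M (\<lambda>x. f x - g x)"
  using square_integrable_add[OF assms(1) square_integrable_scale[OF assms(2), of "-1"]] by simp

lemma square_integrable_sum:
  assumes "\<And>i. i \<in> A \<Longrightarrow> square_integrable M (f i)"
  shows "square_integrable M (\<lambda>x. \<Sum>i\<in>A. f i x)"
  using assms by (induction A rule: infinite_finite_induct) (auto intro!: square_integrable_add)

lemma square_integrable_cong:
  assumes "\<And>x. x \<in> space M \<Longrightarrow> f x = g x"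
  shows "square_integrable M f \<longleftrightarrow> square_integrable M g"
proof -
  have "f \<in> borel_measurable M \<longleftrightarrow> g \<in> borel_measurable M" by (rule measurable_cong) (rule assms)
  moreover have "integrable M (\<lambda>x. (cmod (f x))\<^sup>2) \<longleftrightarrow> integrable M (\<lambda>x. (cmod (g x))\<^sup>2)"
    by (rule Bochner_Integration.integrable_cong) (simp_all add: assms)
  ultimately show ?thesis by (simp add: square_integrable_def)
qed

lemma square_integrable_cong_AE:
  assumes "square_integrable M f" "g \<in> borel_measurable M" "AE x in M. g x = f x"
  shows "square_integrable M g"
proof -
  have "integrable M (\<lambda>x. (cmod (g x))\<^sup>2) \<longleftrightarrow> integrable M (\<lambda>x. (cmod (f x))\<^sup>2)"
    using assms by (intro Bochner_Integration.integrable_cong_AE) (auto simp: square_integrable_def)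
  then show ?thesis using assms by (auto simp: square_integrable_def)
qed

lemma integrable_ip:
  assumes "square_integrable M f" "square_integrable M g"
  shows "integrable M (\<lambda>x. f x * cnj (g x))"
proof -
  have [measurable]: "f \<in> borel_measurable M" "g \<in> borel_measurable M"
    using assms by (auto simp: square_integrable_def)
  have int: "integrable M (\<lambda>x. (cmod (f x))\<^sup>2 + (cmod (g x))\<^sup>2)"
    using assms by (auto simp: square_integrable_def)
  have *: "cmod (f x * cnj (g x)) \<le> (cmod (f x))\<^sup>2 + (cmod (g x))\<^sup>2" for x
    using zero_le_power2[of "cmod (f x) - cmod (g x)"] mult_nonneg_nonneg[OF norm_ge_zero norm_ge_zero, of "f x" "g x"]
    unfolding norm_mult complex_mod_cnj power2_diff by linarith
  show ?thesis
    by (rule Bochner_Integration.integrable_bound[OF int]) (use * in auto)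
qed

lemma ip_add_left:
  assumes "square_integrable M f" "square_integrable M g" "square_integrable M h"
  shows "ip M (\<lambda>x. f x + g x) h = ip M f h + ip M g h"
  using assms by (simp add: ip_def ring_distribs integrable_ip)

lemma ip_diff_left:
  assumes "square_integrable M f" "square_integrable M g" "square_integrable M h"
  shows "ip M (\<lambda>x. f x - g x) h = ip M f h - ip M g h"
  using assms by (simp add: ip_def ring_distribs integrable_ip)

lemma ip_scale_left: "ip M (\<lambda>x. c * f x) h = c * ip M f h"
  by (simp add: ip_def mult.assoc)

lemma ip_commute: "ip M g f = cnj (ip M f g)"
  unfolding ip_def Bochner_Integration.integral_cnj[symmetric] by (simp add: mult.commute)

lemma ip_diff_right:
  assumes "square_integrable M f" "square_integrable M g" "square_integrable M h"
  shows "ip M h (\<lambda>x. f x - g x) = ip M h f - ip M h g"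
  using ip_diff_left[OF assms] by (metis complex_cnj_diff ip_commute)

lemma ip_add_right:
  assumes "square_integrable M f" "square_integrable M g" "square_integrable M h"
  shows "ip M h (\<lambda>x. f x + g x) = ip M h f + ip M h g"
  using ip_add_left[OF assms] by (metis complex_cnj_add ip_commute)

lemma ip_scale_right: "ip M h (\<lambda>x. c * f x) = cnj c * ip M h f"
  using ip_scale_left[of M c f h] by (metis complex_cnj_mult ip_commute)

lemma ip_sum_left:
  assumes "\<And>i. i \<in> A \<Longrightarrow> square_integrable M (f i)" "square_integrable M h"
  shows "ip M (\<lambda>x. \<Sum>i\<in>A. f i x) h = (\<Sum>i\<in>A. ip M (f i) h)"
  using assms
  by (simp add: ip_def sum_distrib_right Bochner_Integration.integral_sum integrable_ip)

lemma ip_sum_right: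
  assumes "\<And>i. i \<in> A \<Longrightarrow> square_integrable M (f i)" "square_integrable M h"
  shows "ip M h (\<lambda>x. \<Sum>i\<in>A. f i x) = (\<Sum>i\<in>A. ip M h (f i))"
proof -
  have "ip M h (\<lambda>x. \<Sum>i\<in>A. f i x) = cnj (\<Sum>i\<in>A. ip M (f i) h)"
    by (subst ip_commute) (simp only: ip_sum_left[OF assms])
  also have "\<dots> = (\<Sum>i\<in>A. ip M h (f i))"
    by (simp add: ip_commute[of M h])
  finally show ?thesis .
qed

lemma ip_self: "ip M f f = of_real (nsq M f)"
  unfolding ip_def nsq_def integral_complex_of_real[symmetric]
  by (simp add: complex_norm_square flip: of_real_power)

lemma nsq_nonneg [simp]: "nsq M f \<ge> 0"
  by (simp add: nsq_def)

lemma ip_cong: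
  assumes "\<And>x. x \<in> space M \<Longrightarrow> f x = f' x" "\<And>x. x \<in> space M \<Longrightarrow> g x = g' x"
  shows "ip M f g = ip M f' g'"
  unfolding ip_def by (rule Bochner_Integration.integral_cong) (simp_all add: assms)

lemma ip_cong_AE:
  assumes "f \<in> borel_measurable M" "f' \<in> borel_measurable M" "AE x in M. f x = f' x"
    and "g \<in> borel_measurable M" "g' \<in> borel_measurable M" "AE x in M. g x = g' x"
  shows "ip M f g = ip M f' g'"
proof -
  note [measurable] = assms(1,2,4,5)
  have "AE x in M. f x * cnj (g x) = f' x * cnj (g' x)"
    using assms(3,6) by eventually_elim simp
  then show ?thesis
    unfolding ip_def by (intro integral_cong_AE) auto
qed

lemma nsq_eq_0_iff:
  assumes "square_integrable M f"
  shows "nsq M f = 0 \<longleftrightarrow> (AE x in M. f x = 0)"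
  using assms unfolding nsq_def square_integrable_def
  by (subst integral_nonneg_eq_0_iff_AE) auto

lemma ip_Cauchy_Schwarz:
  assumes f: "square_integrable M f" and g: "square_integrable M g"
  shows "(cmod (ip M f g))\<^sup>2 \<le> nsq M f * nsq M g"
proof (cases "nsq M g = 0")
  case True
  then have "AE x in M. g x = 0" using g nsq_eq_0_iff by blast
  then have "ip M f g = ip M f (\<lambda>_. 0)"
    using f g by (intro ip_cong_AE) (auto simp: square_integrable_def)
  then show ?thesis by (simp add: ip_def)
next
  case False
  then have B: "nsq M g > 0" by (simp add: order_less_le)
  define c where "c = ip M f g"
  define b where "b = complex_of_real (nsq M g)"
  \<comment> \<open>\<open>h\<close> is \<open>nsq M g\<close> times the component of
    \<open>f\<close> orthogonal to \<open>g\<close>, scaled to avoid division. Its squared norm is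
    \<open>nsq M g\<close> times the gap in the inequality.\<close>
  define h where "h = (\<lambda>x. b * f x - c * g x)"
  have bf: "square_integrable M (\<lambda>x. b * f x)" and cg: "square_integrable M (\<lambda>x. c * g x)"
    using f g by (auto intro: square_integrable_scale)
  have h: "square_integrable M h"
    unfolding h_def by (intro square_integrable_diff bf cg)
  have "complex_of_real (nsq M h) = b * cnj b * ip M f f - b * cnj c * ip M f g
          - c * cnj b * ip M g f + c * cnj c * ip M g g"
    unfolding ip_self[symmetric] h_def
    by (subst ip_diff_left[OF bf cg square_integrable_diff[OF bf cg]],
        subst ip_diff_right[OF bf cg bf], subst ip_diff_right[OF bf cg cg])
      (simp add: ip_scale_left ip_scale_right algebra_simps)
  also have "\<dots> = b * b * of_real (nsq M f) - b * (c * cnj c)"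
    by (simp add: ip_self b_def c_def ip_commute[of M g f] algebra_simps)
  also have "c * cnj c = of_real ((cmod c)\<^sup>2)"
    by (simp add: complex_norm_square flip: of_real_power)
  also have "b * b * of_real (nsq M f) - b * of_real ((cmod c)\<^sup>2) =
      of_real (nsq M g * (nsq M g * nsq M f - (cmod c)\<^sup>2))"
    by (simp add: b_def algebra_simps)
  finally have "nsq M g * (nsq M g * nsq M f - (cmod c)\<^sup>2) = nsq M h"
    using of_real_eq_iff by metis
  then have "nsq M g * (nsq M g * nsq M f - (cmod c)\<^sup>2) \<ge> 0" by simp
  then show ?thesis using B by (simp add: zero_le_mult_iff c_def mult.commute)
qed

section \<open>Square-summable families and their finite partial sums\<close>

lemma square_integrable_count_space:
  "square_integrable (count_space I) f \<longleftrightarrow> integrable (count_space I) (\<lambda>i. (cmod (f i))\<^sup>2)"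
  by (simp add: square_integrable_def)

text \<open>Bessel's inequality yields bounds on finite sums only; this turns them into
  integrability for counting measure on an index set of any size.\<close>

lemma summable_on_imp_integrable_count_space:
  fixes f :: "'i \<Rightarrow> real"
  assumes "\<And>i. i \<in> I \<Longrightarrow> f i \<ge> 0" and "\<And>F. finite F \<Longrightarrow> F \<subseteq> I \<Longrightarrow> (\<Sum>i\<in>F. f i) \<le> C"
  shows "integrable (count_space I) f"
proof -
  have "bdd_above (sum (\<lambda>x. norm (f x)) ` {F. F \<subseteq> I \<and> finite F})"
  proof (rule bdd_aboveI2)
    fix F assume F: "F \<in> {F. F \<subseteq> I \<and> finite F}"
    then have "(\<Sum>i\<in>F. norm (f i)) = (\<Sum>i\<in>F. f i)"
      using assms(1) by (intro sum.cong) auto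
    then show "(\<Sum>i\<in>F. norm (f i)) \<le> C" using assms(2) F by auto
  qed
  then have "(\<lambda>i. norm (f i)) summable_on I"
    by (subst Infinite_Sum.abs_summable_iff_bdd_above)
  then have "Infinite_Set_Sum.abs_summable_on f I"
    by (rule abs_summable_equivalent[THEN iffD1])
  then show ?thesis
    by (simp add: Infinite_Set_Sum.abs_summable_on_def)
qed

text \<open>The integral over counting measure is the limit of the finite partial sums along the net
  of finite subsets. Prescribing the tails fixes the speed of convergence in
  \<open>Riesz_Fischer\<close>.\<close>

lemma infinite_sum_tail:
  assumes c: "square_integrable (count_space I) c" and e: "e > 0"
  obtains F where "finite F" "F \<subseteq> I" "nsq (count_space I) c - (\<Sum>i\<in>F. (cmod (c i))\<^sup>2) \<le> e"
proof -
  define a where "a i = (cmod (c i))\<^sup>2" for i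
  have a: "Infinite_Set_Sum.abs_summable_on a I"
    using c by (simp add: square_integrable_count_space abs_summable_on_def a_def)
  then have "(\<lambda>i. norm (a i)) summable_on I"
    by (rule abs_summable_equivalent[THEN iffD2])
  then have "a summable_on I" by (simp add: a_def[abs_def])
  then have "(a has_sum nsq (count_space I) c) I"
    using infsetsum_infsum[OF a] by (simp add: nsq_def infsetsum_def a_def has_sum_infsum)
  then have "\<forall>\<^sub>F F in finite_subsets_at_top I. dist (sum a F) (nsq (count_space I) c) < e"
    using e by (simp add: has_sum_def tendsto_iff)
  then obtain F where "finite F" "F \<subseteq> I" "dist (sum a F) (nsq (count_space I) c) < e"
    by (auto simp: eventually_finite_subsets_at_top)
  then show ?thesis using that[of F] by (auto simp: dist_real_def a_def)
qed

lemma square_integrable_count_space_restrict: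
  assumes "square_integrable (count_space I) c"
  shows "square_integrable (count_space I) (\<lambda>i. if P i then c i else 0)"
  unfolding square_integrable_count_space
  by (rule Bochner_Integration.integrable_bound[OF assms[unfolded square_integrable_count_space]]) auto

lemma ip_count_space_finite:
  assumes "finite F" "F \<subseteq> I"
  shows "ip (count_space I) a (\<lambda>i. if i \<in> F then c i else 0) = (\<Sum>i\<in>F. a i * cnj (c i))"
proof -
  have "{i \<in> I. a i * cnj (if i \<in> F then c i else 0) \<noteq> 0} \<subseteq> F" by auto
  then show ?thesis
    unfolding ip_def using assms
    by (subst lebesgue_integral_count_space_finite_support)
      (auto intro!: sum.mono_neutral_cong_left intro: finite_subset split: if_splits)
qed

lemma ip_count_space_remainder:
  assumes "finite F" "F \<subseteq> I" "square_integrable (count_space I) a" "square_integrable (count_space I) c"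
  shows "ip (count_space I) a (\<lambda>i. if i \<notin> F then c i else 0)
    = ip (count_space I) a c - (\<Sum>i\<in>F. a i * cnj (c i))"
proof -
  have "ip (count_space I) a (\<lambda>i. if i \<notin> F then c i else 0)
      = ip (count_space I) a (\<lambda>i. c i - (if i \<in> F then c i else 0))"
    by (rule arg_cong[where f = "ip _ _"]) auto
  also have "\<dots> = ip (count_space I) a c - (\<Sum>i\<in>F. a i * cnj (c i))"
    by (subst ip_diff_right)
      (auto simp: ip_count_space_finite assms square_integrable_count_space_restrict)
  finally show ?thesis .
qed

lemma nsq_count_space_remainder:
  assumes "finite F" "F \<subseteq> I" "square_integrable (count_space I) c"
  shows "nsq (count_space I) (\<lambda>i. if i \<notin> F then c i else 0)
    = nsq (count_space I) c - (\<Sum>i\<in>F. (cmod (c i))\<^sup>2)"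
proof -
  let ?r = "\<lambda>i. if i \<notin> F then c i else 0"
  \<comment> \<open>Where the remainder is nonzero it coincides with \<open>c\<close>, so pairing it
    with \<open>c\<close> already gives its squared norm.\<close>
  have "complex_of_real (nsq (count_space I) ?r) = ip (count_space I) c ?r"
    unfolding ip_self[symmetric] by (auto simp: ip_def intro!: Bochner_Integration.integral_cong)
  also have "\<dots> = of_real (nsq (count_space I) c - (\<Sum>i\<in>F. (cmod (c i))\<^sup>2))"
    using assms by (simp add: ip_count_space_remainder ip_self complex_norm_square del: of_real_power)
  finally show ?thesis using of_real_eq_iff by blast
qed

section \<open>Completeness\<close>

text \<open>The geometric rate plays the role of passing to a fast subsequence: the increments are
  summable almost everywhere, and Fatou's lemma in \<open>m\<close> with \<open>n\<close> fixed
  carries the bound over to the pointwise limit.\<close>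

lemma L2_limit:
  fixes g :: "nat \<Rightarrow> 'x \<Rightarrow> complex"
  assumes g: "\<And>n. square_integrable M (g n)"
    and le: "\<And>m n. n \<le> m \<Longrightarrow> nsq M (\<lambda>x. g m x - g n x) \<le> (1/4) ^ n"
  obtains h where "square_integrable M h" "\<And>n. nsq M (\<lambda>x. g n x - h x) \<le> (1/4) ^ n"
proof -
  have gm [measurable]: "g n \<in> borel_measurable M" for n
    using g by (simp add: square_integrable_def)
  define d where "d n x = cmod (g (Suc n) x - g n x)" for n x
  have dm [measurable]: "d n \<in> borel_measurable M" for n unfolding d_def by measurable
  have nn: "(\<integral>\<^sup>+x. ennreal ((cmod (g m x - g n x))\<^sup>2) \<partial>M) \<le> ennreal ((1/4) ^ n)" if "n \<le> m" for m n
    using le[OF that] square_integrable_diff[OF g g, of m n]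
    by (subst nn_integral_eq_integral) (auto simp: square_integrable_def nsq_def intro: ennreal_leI)
  have "(\<integral>\<^sup>+x. (\<Sum>n. ennreal (2 ^ n * (d n x)\<^sup>2)) \<partial>M) = (\<Sum>n. \<integral>\<^sup>+x. ennreal (2 ^ n * (d n x)\<^sup>2) \<partial>M)"
    by (intro nn_integral_suminf) auto
  \<comment> \<open>On a space of infinite measure an L2 bound gives no L1 bound, hence squares are
    summed. The weight 2^n is small enough to leave 2^n / 4^n summable and large enough to control
    the increments themselves below.\<close>
  also have "\<dots> \<le> (\<Sum>n. ennreal ((1/2) ^ n))"
  proof (intro suminf_le)
    fix n
    have "(\<integral>\<^sup>+x. ennreal (2 ^ n * (d n x)\<^sup>2) \<partial>M) = ennreal (2 ^ n) * (\<integral>\<^sup>+x. ennreal ((d n x)\<^sup>2) \<partial>M)"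
      by (simp add: ennreal_mult nn_integral_cmult)
    also have "\<dots> \<le> ennreal (2 ^ n) * ennreal ((1/4) ^ n)"
      unfolding d_def by (intro mult_left_mono nn) auto
    also have "\<dots> = ennreal ((1/2) ^ n)"
    proof -
      have "(2::real) ^ n * (1/4) ^ n = (2 * (1/4)) ^ n"
        by (rule power_mult_distrib[symmetric])
      then show ?thesis by (subst ennreal_mult[symmetric]) auto
    qed
    finally show "(\<integral>\<^sup>+x. ennreal (2 ^ n * (d n x)\<^sup>2) \<partial>M) \<le> ennreal ((1/2) ^ n)" .
  qed auto
  also have "\<dots> = ennreal (\<Sum>n. (1/2) ^ n)"
    by (rule suminf_ennreal2) (auto intro: summable_geometric)
  also have "\<dots> < \<infinity>" by simp
  finally have "AE x in M. (\<Sum>n. ennreal (2 ^ n * (d n x)\<^sup>2)) \<noteq> \<infinity>"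
    by (intro nn_integral_PInf_AE) (auto simp: top.not_eq_extremum)
  then have conv: "AE x in M. (\<lambda>n. g n x) \<longlonglongrightarrow> lim (\<lambda>n. g n x)"
  proof eventually_elim
    case (elim x)
    then have s: "summable (\<lambda>n. 2 ^ n * (d n x)\<^sup>2)"
      by (intro summable_suminf_not_top) auto
    \<comment> \<open>If \<open>d n x\<close> exceeds 2^(-n), then 2^n * d n x is at least 1, and
      multiplying it by \<open>d n x\<close> gives the second summand.\<close>
    have bound: "d n x \<le> (1/2) ^ n + 2 ^ n * (d n x)\<^sup>2" for n
    proof (cases "d n x \<le> (1/2) ^ n")
      case True
      then show ?thesis by (simp add: add_increasing2)
    next
      case False
      then have "1 \<le> 2 ^ n * d n x" by (simp add: field_simps)
      then have "1 * d n x \<le> (2 ^ n * d n x) * d n x"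
        by (intro mult_right_mono) (auto simp: d_def)
      then show ?thesis by (simp add: power2_eq_square mult.assoc add_increasing)
    qed
    have "summable (\<lambda>n. (1/2) ^ n + 2 ^ n * (d n x)\<^sup>2)"
      by (rule summable_add[OF summable_geometric s]) simp
    then have "summable (\<lambda>n. g (Suc n) x - g n x)"
      by (rule summable_comparison_test'[where N = 0]) (use bound in \<open>simp add: d_def\<close>)
    then have "convergent (\<lambda>n. \<Sum>k<n. g (Suc k) x - g k x)"
      by (simp add: summable_iff_convergent)
    then have "convergent (\<lambda>n. g n x - g 0 x)"
      by (simp only: sum_lessThan_telescope[of "\<lambda>k. g k x"])
    then have "convergent (\<lambda>n. g n x - g 0 x + g 0 x)"
      by (rule convergent_add) (rule convergent_const)
    then have "convergent (\<lambda>n. g n x)" by simp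
    then show ?case by (simp add: convergent_LIMSEQ_iff)
  qed
  define h where "h x = lim (\<lambda>n. g n x)" for x
  have hm [measurable]: "h \<in> borel_measurable M" unfolding h_def by measurable
  have fat: "(\<integral>\<^sup>+x. ennreal ((cmod (g n x - h x))\<^sup>2) \<partial>M) \<le> ennreal ((1/4) ^ n)" for n
  proof -
    have "(\<integral>\<^sup>+x. ennreal ((cmod (g n x - h x))\<^sup>2) \<partial>M)
        \<le> (\<integral>\<^sup>+x. liminf (\<lambda>m. ennreal ((cmod (g m x - g n x))\<^sup>2)) \<partial>M)"
    proof (intro nn_integral_mono_AE, use conv in eventually_elim)
      case (elim x)
      have "(\<lambda>m. ennreal ((cmod (g m x - g n x))\<^sup>2)) \<longlonglongrightarrow> ennreal ((cmod (h x - g n x))\<^sup>2)"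
        using elim unfolding h_def by (intro tendsto_ennrealI tendsto_intros)
      then have "liminf (\<lambda>m. ennreal ((cmod (g m x - g n x))\<^sup>2)) = ennreal ((cmod (h x - g n x))\<^sup>2)"
        by (rule lim_imp_Liminf[OF sequentially_bot])
      then show ?case by (simp only: norm_minus_commute order.refl)
    qed
    also have "\<dots> \<le> liminf (\<lambda>m. \<integral>\<^sup>+x. ennreal ((cmod (g m x - g n x))\<^sup>2) \<partial>M)"
      by (intro nn_integral_liminf) auto
    also have "\<dots> \<le> limsup (\<lambda>m. \<integral>\<^sup>+x. ennreal ((cmod (g m x - g n x))\<^sup>2) \<partial>M)"
      by (intro Liminf_le_Limsup) auto
    also have "\<dots> \<le> ennreal ((1/4) ^ n)"
      by (rule Limsup_bounded, rule eventually_sequentiallyI[of n], rule nn)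
    finally show ?thesis .
  qed
  have diff: "square_integrable M (\<lambda>x. g n x - h x)" for n
    unfolding square_integrable_def
  proof (intro conjI integrableI_nonneg)
    show "(\<integral>\<^sup>+x. ennreal ((cmod (g n x - h x))\<^sup>2) \<partial>M) < \<infinity>"
      using le_less_trans[OF fat[of n]] by simp
  qed simp_all
  have "square_integrable M (\<lambda>x. g 0 x - (g 0 x - h x))"
    by (intro square_integrable_diff g diff)
  then have "square_integrable M h" by simp
  moreover have "nsq M (\<lambda>x. g n x - h x) \<le> (1/4) ^ n" for n
    using fat[of n] diff[of n]
    by (subst (asm) nn_integral_eq_integral) (auto simp: square_integrable_def nsq_def)
  ultimately show ?thesis using that by blast
qed

section \<open>Orthonormal families\<close>

lemma L2_class_eq_iff:
  assumes "f \<in> borel_measurable M" "g \<in> borel_measurable M"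
  shows "L2_class M f = L2_class M g \<longleftrightarrow> (AE x in M. f x = g x)"
proof
  assume "L2_class M f = L2_class M g"
  moreover have "f \<in> L2_class M f" using assms by (simp add: L2_class_def)
  ultimately show "AE x in M. f x = g x" by (auto simp: L2_class_def)
next
  assume *: "AE x in M. f x = g x"
  have "(AE x in M. h x = f x) \<longleftrightarrow> (AE x in M. h x = g x)" for h
  proof
    assume "AE x in M. h x = f x" then show "AE x in M. h x = g x" using * by eventually_elim simp
  next
    assume "AE x in M. h x = g x" then show "AE x in M. h x = f x" using * by eventually_elim simp
  qed
  then show "L2_class M f = L2_class M g" by (simp add: L2_class_def)
qed

lemma L2_rep_class:
  assumes "f \<in> borel_measurable M"
  shows "L2_rep (L2_class M f) \<in> borel_measurable M" "AE x in M. L2_rep (L2_class M f) x = f x"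
proof -
  have "f \<in> L2_class M f" using assms by (simp add: L2_class_def)
  then have "L2_rep (L2_class M f) \<in> L2_class M f" 
    unfolding L2_rep_def by (rule someI[of "\<lambda>h. h \<in> L2_class M f"])
  then show "L2_rep (L2_class M f) \<in> borel_measurable M" "AE x in M. L2_rep (L2_class M f) x = f x"
    by (auto simp: L2_class_def)
qed

lemma square_integrable_L2_rep:
  assumes "F \<in> hcarrier (L2 M)"
  shows "square_integrable M (L2_rep F)" "L2_class M (L2_rep F) = F"
proof -
  obtain f where f: "square_integrable M f" "F = L2_class M f" using assms by (auto simp: L2_def)
  then have "f \<in> borel_measurable M" by (simp add: square_integrable_def)
  note rep = L2_rep_class[OF this]
  show "square_integrable M (L2_rep F)"
    unfolding f(2) by (rule square_integrable_cong_AE[OF f(1) rep])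
  show "L2_class M (L2_rep F) = F"
    unfolding f(2) using rep L2_class_eq_iff[OF rep(1) \<open>f \<in> borel_measurable M\<close>] by blast
qed

lemma L2_class_in_hcarrier: "square_integrable M f \<Longrightarrow> L2_class M f \<in> hcarrier (L2 M)"
  by (auto simp: L2_def)

lemma hinner_L2:
  assumes "f \<in> borel_measurable M" "g \<in> borel_measurable M"
  shows "hinner (L2 M) (L2_class M f) (L2_class M g) = ip M f g"
proof -
  have "hinner (L2 M) (L2_class M f) (L2_class M g)
      = ip M (L2_rep (L2_class M f)) (L2_rep (L2_class M g))"
    by (simp add: L2_def ip_def)
  also have "\<dots> = ip M f g"
    using assms by (intro ip_cong_AE L2_rep_class)
  finally show ?thesis .
qed

lemma hadd_L2:
  assumes "f \<in> borel_measurable M" "g \<in> borel_measurable M"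
  shows "hadd (L2 M) (L2_class M f) (L2_class M g) = L2_class M (\<lambda>x. f x + g x)"
proof -
  note [measurable] = assms L2_rep_class(1)[OF assms(1)] L2_rep_class(1)[OF assms(2)]
  have "AE x in M. L2_rep (L2_class M f) x + L2_rep (L2_class M g) x = f x + g x"
    using L2_rep_class(2)[OF assms(1)] L2_rep_class(2)[OF assms(2)] by eventually_elim simp
  then show ?thesis
    by (simp add: L2_def L2_class_eq_iff)
qed

lemma hscale_L2:
  assumes "f \<in> borel_measurable M"
  shows "hscale (L2 M) c (L2_class M f) = L2_class M (\<lambda>x. c * f x)"
proof -
  note [measurable] = assms L2_rep_class(1)[OF assms]
  have "AE x in M. c * L2_rep (L2_class M f) x = c * f x"
    using L2_rep_class(2)[OF assms] by eventually_elim simp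
  then show ?thesis
    by (simp add: L2_def L2_class_eq_iff)
qed

lemma hdist_L2:
  assumes "square_integrable M f" "square_integrable M g"
  shows "hdist (L2 M) (L2_class M f) (L2_class M g) = sqrt (nsq M (\<lambda>x. f x - g x))"
proof -
  have [measurable]: "f \<in> borel_measurable M" "g \<in> borel_measurable M"
    using assms by (auto simp: square_integrable_def)
  show ?thesis
    by (simp add: hdist_def hscale_L2 hadd_L2 hinner_L2 ip_self)
qed

section \<open>Bessel, Riesz-Fischer and Parseval for an orthonormal family\<close>

locale orthonormal_family =
  fixes M :: "'x measure" and I :: "'i set" and \<phi> :: "'i \<Rightarrow> 'x \<Rightarrow> complex"
  assumes sq: "\<alpha> \<in> I \<Longrightarrow> square_integrable M (\<phi> \<alpha>)"
    and orthonormal: "\<alpha> \<in> I \<Longrightarrow> \<beta> \<in> I \<Longrightarrow> ip M (\<phi> \<alpha>) (\<phi> \<beta>) = (if \<alpha> = \<beta> then 1 else 0)"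
begin

abbreviation \<nu> :: "'i measure" where "\<nu> \<equiv> count_space I"

definition comb :: "'i set \<Rightarrow> ('i \<Rightarrow> complex) \<Rightarrow> 'x \<Rightarrow> complex" where
  "comb F c x = (\<Sum>\<alpha>\<in>F. c \<alpha> * \<phi> \<alpha> x)"

definition coeff :: "('x \<Rightarrow> complex) \<Rightarrow> 'i \<Rightarrow> complex" where
  "coeff f \<alpha> = ip M f (\<phi> \<alpha>)"

lemma square_integrable_comb: "F \<subseteq> I \<Longrightarrow> square_integrable M (comb F c)"
  unfolding comb_def by (intro square_integrable_sum square_integrable_scale sq) auto

lemma ip_comb:
  assumes "F \<subseteq> I" "square_integrable M f"
  shows "ip M f (comb F c) = (\<Sum>\<alpha>\<in>F. coeff f \<alpha> * cnj (c \<alpha>))"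
  unfolding comb_def using assms
  by (subst ip_sum_right) (auto intro!: square_integrable_scale sq sum.cong simp: ip_scale_right coeff_def subset_iff)

lemma coeff_comb:
  assumes "finite F" "F \<subseteq> I" "\<alpha> \<in> I"
  shows "coeff (comb F c) \<alpha> = (if \<alpha> \<in> F then c \<alpha> else 0)"
proof -
  have "coeff (comb F c) \<alpha> = (\<Sum>\<beta>\<in>F. c \<beta> * ip M (\<phi> \<beta>) (\<phi> \<alpha>))"
    unfolding comb_def coeff_def using assms
    by (subst ip_sum_left) (auto intro!: square_integrable_scale sq sum.cong simp: ip_scale_left subset_iff)
  also have "\<dots> = (\<Sum>\<beta>\<in>F. if \<beta> = \<alpha> then c \<alpha> else 0)"
    using assms by (intro sum.cong) (auto simp: orthonormal subset_iff)
  finally show ?thesis using assms by simp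
qed

lemma nsq_comb:
  assumes "finite F" "F \<subseteq> I"
  shows "nsq M (comb F c) = (\<Sum>\<alpha>\<in>F. (cmod (c \<alpha>))\<^sup>2)"
proof -
  have "complex_of_real (nsq M (comb F c)) = (\<Sum>\<alpha>\<in>F. c \<alpha> * cnj (c \<alpha>))"
    unfolding ip_self[symmetric] using assms
    by (subst ip_comb) (auto intro!: square_integrable_comb sum.cong simp: coeff_comb subset_iff)
  also have "\<dots> = of_real (\<Sum>\<alpha>\<in>F. (cmod (c \<alpha>))\<^sup>2)"
    by (simp add: complex_norm_square del: of_real_power)
  finally show ?thesis using of_real_eq_iff by blast
qed

text \<open>Cauchy-Schwarz against the partial sum \<open>comb F (coeff f)\<close>: its inner
  product with \<open>f\<close> and its squared norm both equal the left-hand side \<open>s\<close>,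
  so s^2 is at most \<open>nsq M f * s\<close>, and \<open>s\<close> cancels.\<close>

lemma Bessel:
  assumes f: "square_integrable M f" and F: "finite F" "F \<subseteq> I"
  shows "(\<Sum>\<alpha>\<in>F. (cmod (coeff f \<alpha>))\<^sup>2) \<le> nsq M f"
proof -
  define s where "s = (\<Sum>\<alpha>\<in>F. (cmod (coeff f \<alpha>))\<^sup>2)"
  have "ip M f (comb F (coeff f)) = of_real s"
    using F by (simp add: ip_comb f s_def complex_norm_square del: of_real_power)
  then have "s\<^sup>2 \<le> nsq M f * s"
    using ip_Cauchy_Schwarz[OF f square_integrable_comb[OF F(2)], of "coeff f"] F
    by (simp add: nsq_comb s_def del: of_real_sum)
  moreover have "s \<ge> 0" by (simp add: s_def sum_nonneg)
  ultimately have "s \<le> nsq M f"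
    using nsq_nonneg[of M f] by (cases "s = 0") (auto simp: mult_le_cancel_right power2_eq_square)
  then show ?thesis by (simp only: s_def)
qed

lemma square_integrable_coeff:
  assumes "square_integrable M f"
  shows "square_integrable \<nu> (coeff f)"
  unfolding square_integrable_count_space
  by (rule summable_on_imp_integrable_count_space[where C = "nsq M f"]) (auto intro: Bessel assms)

text \<open>The weak form of the conclusion serves twice: testing with a member of the family gives
  the coefficients of \<open>h\<close>, and taking for \<open>c\<close> the coefficients of a
  function gives Parseval's identity.\<close>

theorem Riesz_Fischer:
  assumes c: "square_integrable \<nu> c"
  obtains h where "square_integrable M h" "\<And>f. square_integrable M f \<Longrightarrow> ip M f h = ip \<nu> (coeff f) c"
proof -
  have "\<exists>F. finite F \<and> F \<subseteq> I \<and> nsq \<nu> c - (\<Sum>i\<in>F. (cmod (c i))\<^sup>2) \<le> (1/4) ^ n" for n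
    by (rule infinite_sum_tail[OF c, of "(1/4) ^ n"]) auto
  then obtain F0 where F0: "finite (F0 n)" "F0 n \<subseteq> I"
    "nsq \<nu> c - (\<Sum>i\<in>F0 n. (cmod (c i))\<^sup>2) \<le> (1/4) ^ n" for n by metis
  \<comment> \<open>The unions make the sets increasing, so that a difference of partial sums is the
    partial sum over \<open>F m - F n\<close>, bounded by the tail beyond
    \<open>F n\<close>.\<close>
  define F where "F n = (\<Union>k\<le>n. F0 k)" for n
  have F: "finite (F n)" "F n \<subseteq> I" for n using F0 by (auto simp: F_def)
  have F0F: "F0 n \<subseteq> F n" and mono: "n \<le> m \<Longrightarrow> F n \<subseteq> F m" for n m
    by (auto simp: F_def intro: order_trans)
  have tail: "nsq \<nu> c - (\<Sum>i\<in>F n. (cmod (c i))\<^sup>2) \<le> (1/4) ^ n" for n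
    using F0(3)[of n] sum_mono2[OF F(1) F0F, of n "\<lambda>i. (cmod (c i))\<^sup>2"] by simp
  have le: "(\<Sum>i\<in>F n. (cmod (c i))\<^sup>2) \<le> nsq \<nu> c" for n
    using nsq_count_space_remainder[OF F c, of n] nsq_nonneg[of \<nu> "\<lambda>i. if i \<notin> F n then c i else 0"]
    by simp
  have diff: "nsq M (\<lambda>x. comb (F m) c x - comb (F n) c x) \<le> (1/4) ^ n" if "n \<le> m" for m n
  proof -
    have "(\<lambda>x. comb (F m) c x - comb (F n) c x) = comb (F m - F n) c"
      unfolding comb_def by (subst sum_diff[OF F(1) mono[OF that]]) auto
    then have "nsq M (\<lambda>x. comb (F m) c x - comb (F n) c x) = (\<Sum>i\<in>F m - F n. (cmod (c i))\<^sup>2)"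
      using F nsq_comb[of "F m - F n" c] by (simp add: Diff_subset[THEN subset_trans])
    also have "\<dots> = (\<Sum>i\<in>F m. (cmod (c i))\<^sup>2) - (\<Sum>i\<in>F n. (cmod (c i))\<^sup>2)"
      by (rule sum_diff[OF F(1) mono[OF that]])
    finally show ?thesis using tail[of n] le[of m] by simp
  qed
  obtain h where h: "square_integrable M h" "\<And>n. nsq M (\<lambda>x. comb (F n) c x - h x) \<le> (1/4) ^ n"
    using L2_limit[OF square_integrable_comb[OF F(2)] diff] by blast
  have "ip M f h = ip \<nu> (coeff f) c" if f: "square_integrable M f" for f
  proof -
    have lim0: "(\<lambda>n. sqrt (C * (1/4) ^ n)) \<longlonglongrightarrow> 0" for C :: real
    proof -
      have "(\<lambda>n. sqrt (C * (1/4) ^ n)) \<longlonglongrightarrow> sqrt (C * 0)"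
        by (intro tendsto_intros LIMSEQ_power_zero) auto
      then show ?thesis by simp
    qed
    \<comment> \<open>The inner products of \<open>f\<close> with the partial sums converge to both
      sides of the claim, each time by Cauchy-Schwarz: here in \<open>M\<close>, below in counting
      measure.\<close>
    have lim1: "(\<lambda>n. ip M f (comb (F n) c)) \<longlonglongrightarrow> ip M f h"
    proof (rule Lim_transform2[OF tendsto_const])
      show "(\<lambda>n. ip M f h - ip M f (comb (F n) c)) \<longlonglongrightarrow> 0"
      proof (rule Lim_null_comparison[OF _ lim0[of "nsq M f"]], intro always_eventually allI)
        fix n
        have *: "square_integrable M (\<lambda>x. comb (F n) c x - h x)"
          by (intro square_integrable_diff square_integrable_comb F h)
        have "cmod (ip M f h - ip M f (comb (F n) c)) = cmod (ip M f (\<lambda>x. comb (F n) c x - h x))"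
          by (simp add: ip_diff_right square_integrable_comb F h f norm_minus_commute)
        also have "\<dots> \<le> sqrt (nsq M f * nsq M (\<lambda>x. comb (F n) c x - h x))"
          using ip_Cauchy_Schwarz[OF f *] by (rule real_le_rsqrt)
        also have "\<dots> \<le> sqrt (nsq M f * (1/4) ^ n)"
          by (intro real_sqrt_le_mono mult_left_mono h) auto
        finally show "cmod (ip M f h - ip M f (comb (F n) c)) \<le> sqrt (nsq M f * (1/4) ^ n)" .
      qed
    qed
    have sc: "square_integrable \<nu> (coeff f)" by (rule square_integrable_coeff[OF f])
    have lim2: "(\<lambda>n. ip M f (comb (F n) c)) \<longlonglongrightarrow> ip \<nu> (coeff f) c"
    proof (rule Lim_transform2[OF tendsto_const])
      show "(\<lambda>n. ip \<nu> (coeff f) c - ip M f (comb (F n) c)) \<longlonglongrightarrow> 0"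
      proof (rule Lim_null_comparison[OF _ lim0[of "nsq \<nu> (coeff f)"]], intro always_eventually allI)
        fix n
        let ?r = "\<lambda>i. if i \<notin> F n then c i else 0"
        have "ip \<nu> (coeff f) c - ip M f (comb (F n) c) = ip \<nu> (coeff f) ?r"
          by (subst ip_count_space_remainder[OF F sc c]) (simp add: ip_comb F f)
        also have "cmod \<dots> \<le> sqrt (nsq \<nu> (coeff f) * nsq \<nu> ?r)"
          using ip_Cauchy_Schwarz[OF sc square_integrable_count_space_restrict[OF c]]
          by (rule real_le_rsqrt)
        also have "\<dots> \<le> sqrt (nsq \<nu> (coeff f) * (1/4) ^ n)"
          unfolding nsq_count_space_remainder[OF F c]
          by (intro real_sqrt_le_mono mult_left_mono tail) auto
        finally show "cmod (ip \<nu> (coeff f) c - ip M f (comb (F n) c))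
            \<le> sqrt (nsq \<nu> (coeff f) * (1/4) ^ n)" .
      qed
    qed
    show ?thesis by (rule LIMSEQ_unique[OF lim1 lim2])
  qed
  then show ?thesis using that h(1) by blast
qed

text \<open>The weak identity is tested with \<open>\<phi> \<beta>\<close>, whose coefficient family
  is 1 at \<open>\<beta>\<close> and 0 elsewhere.\<close>

lemma coeff_of_weak:
  assumes "square_integrable M h" "\<And>f. square_integrable M f \<Longrightarrow> ip M f h = ip \<nu> (coeff f) c"
    and \<beta>: "\<beta> \<in> I"
  shows "coeff h \<beta> = c \<beta>"
proof -
  have "ip M (\<phi> \<beta>) h = ip \<nu> (coeff (\<phi> \<beta>)) c" by (rule assms(2)[OF sq[OF \<beta>]])
  also have "\<dots> = ip \<nu> (coeff (\<phi> \<beta>)) (\<lambda>i. if i \<in> {\<beta>} then c i else 0)"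
    using \<beta> orthonormal[OF \<beta>] unfolding ip_def[of \<nu>] coeff_def
    by (intro Bochner_Integration.integral_cong) auto
  also have "\<dots> = cnj (c \<beta>)"
    using \<beta> by (subst ip_count_space_finite) (auto simp: coeff_def orthonormal)
  finally show ?thesis by (simp add: coeff_def ip_commute[of M h])
qed

text \<open>\<open>U\<close> is the inverse of the coefficient map. Totality enters through
  \<open>eqI\<close>, that is, injectivity of the coefficient map modulo null sets; surjectivity is
  \<open>Riesz_Fischer\<close>.\<close>

theorem total_imp_unitary_iso:
  assumes total: "\<And>f. square_integrable M f \<Longrightarrow> (\<And>\<alpha>. \<alpha> \<in> I \<Longrightarrow> ip M f (\<phi> \<alpha>) = 0) \<Longrightarrow> AE x in M. f x = 0"
  shows "\<exists>U. unitary_iso (L2 \<nu>) (L2 M) U \<and>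
    (\<forall>g. square_integrable M g \<longrightarrow> U (L2_class \<nu> (\<lambda>\<alpha>. ip M g (\<phi> \<alpha>))) = L2_class M g)"
proof -
  have meas: "f \<in> borel_measurable M" if "square_integrable M f" for f
    using that by (simp add: square_integrable_def)
  have eqI: "AE x in M. f x = g x"
    if f: "square_integrable M f" and g: "square_integrable M g" and "\<And>\<alpha>. \<alpha> \<in> I \<Longrightarrow> coeff f \<alpha> = coeff g \<alpha>" for f g
  proof -
    have "AE x in M. f x - g x = 0"
      using that by (intro total square_integrable_diff) (auto simp: ip_diff_left sq coeff_def)
    then show ?thesis by simp
  qed
  \<comment> \<open>Riesz-Fischer applied to the coefficients of \<open>g\<close> produces a
    function with the same coefficients, hence \<open>g\<close> itself almost everywhere; its weak
    identity is then Parseval's.\<close>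
  have Parseval: "ip M f g = ip \<nu> (coeff f) (coeff g)"
    if f: "square_integrable M f" and g: "square_integrable M g" for f g
  proof -
    obtain h where h: "square_integrable M h" "\<And>f. square_integrable M f \<Longrightarrow> ip M f h = ip \<nu> (coeff f) (coeff g)"
      using Riesz_Fischer[OF square_integrable_coeff[OF g]] by blast
    have "AE x in M. g x = h x"
      by (rule eqI[OF g h(1)]) (simp add: coeff_of_weak[OF h])
    then have "ip M f g = ip M f h" using f g h by (intro ip_cong_AE) (auto intro: meas)
    then show ?thesis using h f by simp
  qed
  \<comment> \<open>For square-summable \<open>c\<close> the choice is harmless: two candidates
    agree almost everywhere by \<open>eqI\<close>.\<close>
  define K where "K c = (SOME h. square_integrable M h \<and> (\<forall>\<alpha>\<in>I. coeff h \<alpha> = c \<alpha>))" for c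
  have K: "square_integrable M (K c) \<and> (\<forall>\<alpha>\<in>I. coeff (K c) \<alpha> = c \<alpha>)" if c: "square_integrable \<nu> c" for c
  proof -
    obtain h where h: "square_integrable M h" "\<And>f. square_integrable M f \<Longrightarrow> ip M f h = ip \<nu> (coeff f) c"
      using Riesz_Fischer[OF c] by blast
    then have "\<exists>h. square_integrable M h \<and> (\<forall>\<alpha>\<in>I. coeff h \<alpha> = c \<alpha>)"
      using coeff_of_weak[OF h] by blast
    then show ?thesis unfolding K_def by (rule someI_ex)
  qed
  define U where "U C = L2_class M (K (L2_rep C))" for C
  have repl: "square_integrable \<nu> (L2_rep C)" if "C \<in> hcarrier (L2 \<nu>)" for C
    using square_integrable_L2_rep[OF that] by simp
  have U: "U (L2_class \<nu> c) = L2_class M g"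
    if g: "square_integrable M g" and c: "\<And>\<alpha>. \<alpha> \<in> I \<Longrightarrow> coeff g \<alpha> = c \<alpha>" for c g
  proof -
    have sc: "square_integrable \<nu> c"
    proof -
      have "integrable \<nu> (\<lambda>i. (cmod (c i))\<^sup>2) \<longleftrightarrow> integrable \<nu> (\<lambda>i. (cmod (coeff g i))\<^sup>2)"
        by (rule Bochner_Integration.integrable_cong) (simp_all add: c)
      then show ?thesis using square_integrable_coeff[OF g] by (simp add: square_integrable_count_space)
    qed
    have C: "L2_class \<nu> c \<in> hcarrier (L2 \<nu>)" using sc by (rule L2_class_in_hcarrier)
    have "AE \<alpha> in \<nu>. L2_rep (L2_class \<nu> c) \<alpha> = c \<alpha>" by (rule L2_rep_class) simp
    then have eq: "L2_rep (L2_class \<nu> c) \<alpha> = c \<alpha>" if "\<alpha> \<in> I" for \<alpha>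
      using that by (simp add: AE_count_space)
    have "AE x in M. K (L2_rep (L2_class \<nu> c)) x = g x"
      using K[OF repl[OF C]] c by (intro eqI g) (auto simp: eq)
    then show ?thesis
      unfolding U_def using K[OF repl[OF C]] g by (subst L2_class_eq_iff) (auto intro: meas)
  qed
  have ex: "\<exists>g. square_integrable M g \<and> C = L2_class \<nu> (coeff g) \<and> U C = L2_class M g"
    if C: "C \<in> hcarrier (L2 \<nu>)" for C
  proof -
    let ?g = "K (L2_rep C)"
    have g: "square_integrable M ?g" "\<forall>\<alpha>\<in>I. coeff ?g \<alpha> = L2_rep C \<alpha>" using K[OF repl[OF C]] by auto
    then have "L2_class \<nu> (coeff ?g) = L2_class \<nu> (L2_rep C)"
      by (subst L2_class_eq_iff) (auto simp: AE_count_space)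
    then show ?thesis using g square_integrable_L2_rep(2)[OF C] by (intro exI[of _ ?g]) (simp add: U_def)
  qed
  have Ucoeff: "U (L2_class \<nu> (coeff g)) = L2_class M g" if "square_integrable M g" for g
    using that by (rule U) simp
  have "unitary_iso (L2 \<nu>) (L2 M) U"
    unfolding unitary_iso_def
  proof (intro conjI ballI allI)
    show "bij_betw U (hcarrier (L2 \<nu>)) (hcarrier (L2 M))"
    proof (rule bij_betw_imageI)
      show "inj_on U (hcarrier (L2 \<nu>))"
      proof (rule inj_onI)
        fix C D assume CD: "C \<in> hcarrier (L2 \<nu>)" "D \<in> hcarrier (L2 \<nu>)" "U C = U D"
        obtain g where g: "square_integrable M g" "C = L2_class \<nu> (coeff g)" "U C = L2_class M g"
          using ex[OF CD(1)] by blast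
        obtain h where h: "square_integrable M h" "D = L2_class \<nu> (coeff h)" "U D = L2_class M h"
          using ex[OF CD(2)] by blast
        have "AE x in M. g x = h x"
          using CD(3) g h L2_class_eq_iff[OF meas meas, OF g(1) h(1)] by simp
        then have "coeff g \<alpha> = coeff h \<alpha>" if "\<alpha> \<in> I" for \<alpha>
          unfolding coeff_def using g h that sq by (intro ip_cong_AE) (auto intro: meas)
        then show "C = D" unfolding g h by (subst L2_class_eq_iff) (auto simp: AE_count_space)
      qed
      show "U ` hcarrier (L2 \<nu>) = hcarrier (L2 M)"
      proof (intro equalityI subsetI)
        fix F assume "F \<in> U ` hcarrier (L2 \<nu>)"
        then show "F \<in> hcarrier (L2 M)" using ex L2_class_in_hcarrier by fastforce
      next
        fix F assume "F \<in> hcarrier (L2 M)"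
        then obtain g where g: "square_integrable M g" "F = L2_class M g" by (auto simp: L2_def)
        then show "F \<in> U ` hcarrier (L2 \<nu>)"
          using Ucoeff[OF g(1)] square_integrable_coeff[OF g(1)]
          by (intro image_eqI[of _ _ "L2_class \<nu> (coeff g)"] L2_class_in_hcarrier) auto
      qed
    qed
  next
    fix C D assume CD: "C \<in> hcarrier (L2 \<nu>)" "D \<in> hcarrier (L2 \<nu>)"
    obtain g where g: "square_integrable M g" "C = L2_class \<nu> (coeff g)" "U C = L2_class M g"
      using ex[OF CD(1)] by blast
    obtain h where h: "square_integrable M h" "D = L2_class \<nu> (coeff h)" "U D = L2_class M h"
      using ex[OF CD(2)] by blast
    show "U (hadd (L2 \<nu>) C D) = hadd (L2 M) (U C) (U D)"
      unfolding g(3) h(3) unfolding g(2) h(2) using g(1) h(1)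
      by (subst hadd_L2, simp, simp, subst hadd_L2)
        (auto intro!: meas U square_integrable_add simp: coeff_def ip_add_left sq)
    show "hinner (L2 M) (U C) (U D) = hinner (L2 \<nu>) C D"
      unfolding g(3) h(3) unfolding g(2) h(2) using g(1) h(1)
      by (subst hinner_L2, simp add: meas, simp add: meas, subst hinner_L2) (auto simp: Parseval)
  next
    fix c C assume C: "C \<in> hcarrier (L2 \<nu>)"
    obtain g where g: "square_integrable M g" "C = L2_class \<nu> (coeff g)" "U C = L2_class M g"
      using ex[OF C] by blast
    show "U (hscale (L2 \<nu>) c C) = hscale (L2 M) c (U C)"
      unfolding g(3) unfolding g(2) using g(1)
      by (subst hscale_L2, simp, subst hscale_L2)
        (auto intro!: meas U square_integrable_scale simp: coeff_def ip_scale_left)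
  qed
  moreover have "U (L2_class \<nu> (\<lambda>\<alpha>. ip M g (\<phi> \<alpha>))) = L2_class M g" if "square_integrable M g" for g
    using that by (rule U) (simp add: coeff_def)
  ultimately show ?thesis by blast
qed

end

section \<open>Absolute values of p-adic numbers\<close>

text \<open>\<open>padic_abs\<close> reads the exponent off the reduced fraction;
  cross-multiplication shows that any fraction gives the same exponent. The ultrametric inequality
  needs this for sums over a common denominator.\<close>

lemma padic_abs_divide:
  assumes p: "prime p" and ab: "a \<noteq> 0" "b \<noteq> 0"
  shows "padic_abs p (of_int a / of_int b)
    = real p powi (int (multiplicity (int p) b) - int (multiplicity (int p) a))"
proof -
  obtain n d where nd: "quotient_of (of_int a / of_int b) = (n, d)" by fastforce
  then have d: "d > 0" by (rule quotient_of_denom_pos)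
  have "rat_of_int a / of_int b = of_int n / of_int d" by (rule quotient_of_div[OF nd])
  then have "rat_of_int (a * d) = of_int (n * b)"
    using d ab by (simp add: field_simps)
  then have eq: "a * d = n * b" using of_int_eq_iff by blast
  then have n: "n \<noteq> 0" using ab d by auto
  have "prime_elem (int p)" using p by simp
  then have "multiplicity (int p) a + multiplicity (int p) d = multiplicity (int p) n + multiplicity (int p) b"
    using eq ab d n by (metis prime_elem_multiplicity_mult_distrib less_irrefl)
  then show ?thesis using ab nd by (simp add: padic_abs_def) (smt (verit) of_nat_add)
qed

lemma rat_divide_cases:
  obtains a b where "x = rat_of_int a / of_int b" "b \<noteq> 0"
  by (metis quotient_of_div quotient_of_denom_pos less_irrefl surj_pair)

lemma padic_abs_nonneg [simp]: "padic_abs p x \<ge> 0"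
  by (simp add: padic_abs_def)

lemma padic_abs_zero [simp]: "padic_abs p 0 = 0"
  by (simp add: padic_abs_def)

lemma padic_abs_eq_0_iff: "prime p \<Longrightarrow> padic_abs p x = 0 \<longleftrightarrow> x = 0"
  by (auto simp: padic_abs_def prime_gt_0_nat)

lemma padic_abs_minus [simp]: "padic_abs p (- x) = padic_abs p x"
proof -
  have "multiplicity (int p) (- a) = multiplicity (int p) a" for a
    using multiplicity_times_unit_right[of "-1" "int p" a] by simp
  then show ?thesis by (simp add: padic_abs_def rat_uminus_code prod.case_eq_if)
qed

lemma padic_abs_ultrametric:
  assumes p: "prime p"
  shows "padic_abs p (x + y) \<le> max (padic_abs p x) (padic_abs p y)"
proof (cases "x = 0 \<or> y = 0 \<or> x + y = 0")
  case True
  then show ?thesis by (auto simp: padic_abs_def max_def)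
next
  case False
  obtain a b where x: "x = rat_of_int a / of_int b" "b \<noteq> 0" by (rule rat_divide_cases)
  obtain c d where y: "y = rat_of_int c / of_int d" "d \<noteq> 0" by (rule rat_divide_cases)
  have a: "a \<noteq> 0" and c: "c \<noteq> 0" using False x y by auto
  have xy: "x + y = rat_of_int (a * d + c * b) / of_int (b * d)"
    using x y by (simp add: field_simps)
  have nz: "a * d + c * b \<noteq> 0"
    using False xy by (metis div_0 of_int_0)
  define m where "m = (\<lambda>z. multiplicity (int p) z)"
  have m_mult: "m (s * t) = m s + m t" if "s \<noteq> 0" "t \<noteq> 0" for s t
    using p that unfolding m_def by (simp add: prime_elem_multiplicity_mult_distrib)
  have "min (m (a * d)) (m (c * b)) \<le> m (a * d + c * b)"
    unfolding m_def using nz prime_gt_1_nat[OF p]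
    by (intro multiplicity_geI dvd_add) (auto intro: multiplicity_dvd')
  then have "min (m a + m d) (m c + m b) \<le> m (a * d + c * b)"
    using a c x y by (simp add: m_mult)
  then have "int (m (b * d)) - int (m (a * d + c * b)) \<le> max (int (m b) - int (m a)) (int (m d) - int (m c))"
    using x y by (auto simp: m_mult)
  moreover have "real p \<ge> 1" using prime_gt_0_nat[OF p] by simp
  ultimately have "real p powi (int (m (b * d)) - int (m (a * d + c * b)))
      \<le> real p powi (max (int (m b) - int (m a)) (int (m d) - int (m c)))"
    by (intro power_int_increasing) auto
  also have "\<dots> \<le> max (real p powi (int (m b) - int (m a))) (real p powi (int (m d) - int (m c)))"
    by (auto simp: max_def)
  finally show ?thesis
    unfolding xy unfolding x y m_def using p a c x y nz by (simp add: padic_abs_divide del: of_int_mult of_int_add)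
qed

lemma padic_abs_triangle:
  assumes "prime p"
  shows "padic_abs p (x + y) \<le> padic_abs p x + padic_abs p y"
  using padic_abs_ultrametric[OF assms, of x y] padic_abs_nonneg[of p x] padic_abs_nonneg[of p y]
  unfolding max_def by (smt (verit))

lemma Metric_space_padic:
  assumes "prime p"
  shows "Metric_space UNIV (\<lambda>x y. padic_abs p (x - y))"
proof
  show "padic_abs p (x - y) = padic_abs p (y - x)" for x y
    using padic_abs_minus[of p "x - y"] by simp
  show "padic_abs p (x - z) \<le> padic_abs p (x - y) + padic_abs p (y - z)" for x y z
    using padic_abs_triangle[OF assms, of "x - y" "y - z"] by simp
qed (use assms in \<open>auto simp: padic_abs_eq_0_iff\<close>)

text \<open>This gives the definite description in \<open>padic_norm\<close> its meaning. By the
  reverse triangle inequality the absolute values along a Cauchy sequence are Cauchy, and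
  representatives of one coset differ by a null sequence, so their limits agree.\<close>

lemma padic_norm_limit:
  assumes p: "prime p" and a: "a \<in> carrier (padic_field p)" and X: "X \<in> a"
  shows "(\<lambda>n. padic_abs p (X n)) \<longlonglongrightarrow> padic_norm p a"
proof -
  interpret Metric_space UNIV "\<lambda>x y. padic_abs p (x - y)" by (rule Metric_space_padic[OF p])
  obtain Z where Z: "Z \<in> carrier (padic_cauchy_ring p)"
    and aZ: "a = padic_null_ideal p +>\<^bsub>padic_cauchy_ring p\<^esub> Z"
    using a by (auto simp: padic_field_def FactRing_def A_RCOSETS_def')
  have diff: "\<bar>padic_abs p x - padic_abs p y\<bar> \<le> padic_abs p (x - y)" for x y
    using padic_abs_triangle[OF p, of "x - y" y] padic_abs_triangle[OF p, of "y - x" x]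
      padic_abs_minus[of p "x - y"] by simp
  have "Cauchy (\<lambda>n. padic_abs p (Z n))"
  proof (rule metric_CauchyI)
    fix e :: real assume "e > 0"
    moreover have "\<forall>e>0. \<exists>N. \<forall>n n'. N \<le> n \<longrightarrow> N \<le> n' \<longrightarrow> padic_abs p (Z n - Z n') < e"
      using Z by (simp add: padic_cauchy_ring_def MCauchy_def)
    ultimately obtain N where "\<And>n n'. N \<le> n \<Longrightarrow> N \<le> n' \<Longrightarrow> padic_abs p (Z n - Z n') < e"
      by blast
    then show "\<exists>M. \<forall>m\<ge>M. \<forall>n\<ge>M. dist (padic_abs p (Z m)) (padic_abs p (Z n)) < e"
      using diff le_less_trans unfolding dist_real_def by blast
  qed
  then obtain r where r: "(\<lambda>n. padic_abs p (Z n)) \<longlonglongrightarrow> r"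
    using Cauchy_convergent_iff convergent_def by blast
  have lim: "(\<lambda>n. padic_abs p (Y n)) \<longlonglongrightarrow> r" if Y: "Y \<in> a" for Y
  proof -
    obtain W where W0: "W \<in> padic_null_ideal p" "Y = W \<oplus>\<^bsub>padic_cauchy_ring p\<^esub> Z"
      using Y unfolding aZ a_r_coset_def' by blast
    then have W: "W \<in> padic_null_ideal p" "Y = (\<lambda>n. W n + Z n)"
      by (simp_all add: padic_cauchy_ring_def)
    have "(\<lambda>n. padic_abs p (Y n) - padic_abs p (Z n)) \<longlonglongrightarrow> 0"
    proof (rule Lim_null_comparison[OF always_eventually])
      show "\<forall>n. norm (padic_abs p (Y n) - padic_abs p (Z n)) \<le> padic_abs p (W n)"
        using diff[of "Y n" "Z n" for n] by (auto simp: W)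
      show "(\<lambda>n. padic_abs p (W n)) \<longlonglongrightarrow> 0" using W by (simp add: padic_null_ideal_def)
    qed
    then show ?thesis using tendsto_add[OF _ r] by fastforce
  qed
  have "padic_norm p a = r"
    unfolding padic_norm_def using X lim by (intro the_equality) (auto intro: LIMSEQ_unique)
  then show ?thesis using lim X by blast
qed

lemma padic_norm_nonneg:
  assumes p: "prime p" and a: "a \<in> carrier (padic_field p)"
  shows "padic_norm p a \<ge> 0"
proof -
  interpret Metric_space UNIV "\<lambda>x y. padic_abs p (x - y)" by (rule Metric_space_padic[OF p])
  obtain Z where "Z \<in> carrier (padic_cauchy_ring p)"
    and aZ: "a = padic_null_ideal p +>\<^bsub>padic_cauchy_ring p\<^esub> Z"
    using a by (auto simp: padic_field_def FactRing_def A_RCOSETS_def')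
  have "(\<lambda>_. 0) \<in> padic_null_ideal p"
    using p by (simp add: padic_null_ideal_def padic_cauchy_ring_def MCauchy_def padic_abs_eq_0_iff)
  then have "Z \<in> a"
    unfolding aZ by (force simp: a_r_coset_def' padic_cauchy_ring_def)
  then have "(\<lambda>n. padic_abs p (Z n)) \<longlonglongrightarrow> padic_norm p a"
    by (rule padic_norm_limit[OF p a])
  then show ?thesis by (rule LIMSEQ_le_const) simp
qed

text \<open>\<open>vacuum\<close> tests membership in the interval from 0 to 1,
  \<open>local_integers\<close> only the upper bound; nonnegativity of the norm reconciles
  them.\<close>

lemma vacuum_prime:
  assumes "prime p" "x \<in> carrier (local_field (Prime_place p))"
  shows "vacuum (Prime_place p) x = indicator (local_integers p) x"
proof -
  have "projr x \<in> carrier (padic_field p)"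
    using assms by (auto simp: image_ring_carrier)
  then have "padic_norm p (projr x) \<ge> 0" by (rule padic_norm_nonneg[OF assms(1)])
  then show ?thesis using assms by (auto simp: local_integers_def indicator_def)
qed

section \<open>Rectangles in the adele ring\<close>

text \<open>The support of an integrable function is covered by the sets where its norm is at least
  1/(n+1), of finite measure by Markov's inequality; the density gives the complement measure 0.
  Applied to factors of products, this makes finite product measures available.\<close>

lemma sigma_finite_density_support:
  fixes h :: "'x \<Rightarrow> 'b::{banach, second_countable_topology}"
  assumes h: "integrable M h"
  shows "sigma_finite_measure (density M (indicator {x \<in> space M. h x \<noteq> 0}))"
proof
  let ?E = "{x \<in> space M. h x \<noteq> 0}" and ?B = "\<lambda>n::nat. {x \<in> space M. norm (h x) \<ge> 1 / real (Suc n)}"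
  have [measurable]: "h \<in> borel_measurable M" using h by auto
  have E: "?E \<in> sets M" by measurable
  have B: "?B n \<in> sets M" for n by measurable
  have fin: "emeasure M (?B n) < \<infinity>" for n
  proof -
    have "emeasure M (?B n) \<le> ennreal (1 / (1 / real (Suc n)) * (\<integral>x. norm (h x) \<partial>M))"
      using h by (intro integral_Markov_inequality) auto
    then show ?thesis by (simp add: le_less_trans)
  qed
  show "\<exists>A. countable A \<and> A \<subseteq> sets (density M (indicator ?E)) \<and> \<Union> A = space (density M (indicator ?E)) \<and>
      (\<forall>a\<in>A. emeasure (density M (indicator ?E)) a \<noteq> \<infinity>)"
  proof (intro exI[of _ "insert (space M - ?E) (range ?B)"] conjI ballI)
    show "\<Union> (insert (space M - ?E) (range ?B)) = space (density M (indicator ?E))"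
    proof -
      have "\<exists>n. norm (h x) \<ge> 1 / real (Suc n)" if "h x \<noteq> 0" for x
        using nat_approx_posE[of "norm (h x)"] that by (metis less_imp_le zero_less_norm_iff)
      then show ?thesis by auto
    qed
    fix a assume "a \<in> insert (space M - ?E) (range ?B)"
    then consider "a = space M - ?E" | n where "a = ?B n" by auto
    then show "emeasure (density M (indicator ?E)) a \<noteq> \<infinity>"
    proof cases
      case 1
      then show ?thesis using E by (simp add: emeasure_restricted)
    next
      case 2
      have "emeasure M (?E \<inter> ?B n) \<le> emeasure M (?B n)" using B by (intro emeasure_mono) auto
      also have "\<dots> < \<infinity>" by (rule fin)
      finally show ?thesis using 2 B E by (simp add: emeasure_restricted)
    qed
  qed (use E B in auto)
qed

section \<open>Local measures, the adelic measure and its measurable rectangles\<close>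

locale adele_measures =
  fixes dx :: "place \<Rightarrow> loc measure" and dxA :: "(place \<Rightarrow> loc) measure"
  assumes dx_Inf: "dx Inf_place = embed_measure lborel Inl"
    and dx_prime: "prime p \<Longrightarrow>
           haar_measure (local_field (Prime_place p)) (local_topology (Prime_place p))
             (dx (Prime_place p))"
    and dx_integers: "prime p \<Longrightarrow> emeasure (dx (Prime_place p)) (local_integers p) = 1"
    and dxA_haar: "haar_measure adele_ring adele_topology dxA"
    and dxA_product: "adele_product_measure dx dxA"
begin

lemma VQ_cases:
  assumes "v \<in> VQ"
  obtains "v = Inf_place" | p where "prime p" "v = Prime_place p"
  using assms by (auto simp: VQ_def)

lemma Inf_VQ: "Inf_place \<in> VQ" and Prime_VQ: "Prime_place p \<in> VQ \<longleftrightarrow> prime p"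
  by (auto simp: VQ_def)

lemma space_dx: "v \<in> VQ \<Longrightarrow> space (dx v) = carrier (local_field v)"
  by (erule VQ_cases)
    (use dx_prime in \<open>auto simp: dx_Inf space_embed_measure image_ring_carrier real_field_def haar_measure_def\<close>)

text \<open>The sets whose indicators are the vacuum functions, the one at infinity
  included.\<close>

definition unit_set :: "place \<Rightarrow> loc set" where
  "unit_set v = (case v of Inf_place \<Rightarrow> Inl ` {0..1} | Prime_place p \<Rightarrow> local_integers p)"

lemma emeasure_unit_set: "v \<in> VQ \<Longrightarrow> emeasure (dx v) (unit_set v) = 1"
  by (erule VQ_cases)
    (use dx_integers in \<open>auto simp: unit_set_def dx_Inf emeasure_embed_measure_image\<close>)

text \<open>Measurability is read off from the value 1, since \<open>emeasure\<close> is 0 on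
  nonmeasurable sets.\<close>

lemma unit_set: "v \<in> VQ \<Longrightarrow> unit_set v \<in> sets (dx v)"
  using emeasure_unit_set[of v] emeasure_notin_sets[of "unit_set v" "dx v"] by fastforce

lemma vacuum_eq:
  assumes "v \<in> VQ" "x \<in> carrier (local_field v)"
  shows "vacuum v x = indicator (unit_set v) x"
  using assms(1)
proof (cases rule: VQ_cases)
  case 1
  then show ?thesis using assms
    by (auto simp: unit_set_def image_ring_carrier indicator_def)
next
  case (2 p)
  then show ?thesis using assms vacuum_prime by (simp add: unit_set_def)
qed

text \<open>The infinite place always belongs to \<open>S\<close>, because
  \<open>adele_rectangle\<close> imposes its default factor at primes only and
  \<open>adele_product_measure\<close> is stated for such sets.\<close>

definition places :: "place set \<Rightarrow> bool" where
  "places S \<longleftrightarrow> finite S \<and> Inf_place \<in> S \<and> S \<subseteq> VQ"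

lemma emeasure_rectangle:
  assumes "places S" "\<And>v. v \<in> S \<Longrightarrow> A v \<in> sets (dx v)"
  shows "emeasure dxA (adele_rectangle S A) = (\<Prod>v\<in>S. emeasure (dx v) (A v))"
  using dxA_product assms by (simp add: adele_product_measure_def places_def)

text \<open>A set of nonzero measure is measurable, since \<^const>\<open>emeasure\<close> is 0 off the sigma-algebra;
  a rectangle with null factors is a difference of rectangles with fewer null factors.\<close>

lemma rectangle_sets:
  assumes S: "places S" and A: "\<And>v. v \<in> S \<Longrightarrow> A v \<in> sets (dx v)"
  shows "adele_rectangle S A \<in> sets dxA"
  using A
proof (induction "card {v \<in> S. emeasure (dx v) (A v) = 0}" arbitrary: A rule: less_induct)
  case less
  have fin: "finite S" and SVQ: "S \<subseteq> VQ" using S by (auto simp: places_def)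
  show ?case
  proof (cases "\<exists>v\<in>S. emeasure (dx v) (A v) = 0")
    case False
    then have "emeasure dxA (adele_rectangle S A) \<noteq> 0"
      using emeasure_rectangle[OF S less.prems] fin by (simp add: prod_zero_iff)
    then show ?thesis using emeasure_notin_sets by blast
  next
    case True
    then obtain w where w: "w \<in> S" "emeasure (dx w) (A w) = 0" by blast
    have wZ: "unit_set w \<in> sets (dx w)" "emeasure (dx w) (unit_set w) = 1"
      using unit_set emeasure_unit_set w SVQ by auto
    \<comment> \<open>With Z the unit set at \<open>w\<close>, the null set \<open>A w\<close> is (A
      w Un Z) - (Z - A w). Both of these have nonzero measure, as Z has measure 1.\<close>
    define A1 where "A1 = A(w := A w \<union> unit_set w)"
    define A2 where "A2 = A(w := unit_set w - A w)"
    have A1: "v \<in> S \<Longrightarrow> A1 v \<in> sets (dx v)" and A2: "v \<in> S \<Longrightarrow> A2 v \<in> sets (dx v)" for v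
      using less.prems wZ w by (auto simp: A1_def A2_def)
    have "emeasure (dx w) (A w \<union> unit_set w) \<noteq> 0"
      using emeasure_mono[of "unit_set w" "A w \<union> unit_set w" "dx w"] wZ less.prems[OF w(1)] by auto
    moreover have "emeasure (dx w) (unit_set w - A w) \<noteq> 0"
      using emeasure_Diff_null_set[of "A w" "dx w" "unit_set w"] wZ w less.prems[OF w(1)] by (auto simp: null_sets_def)
    ultimately have "{v \<in> S. emeasure (dx v) (A1 v) = 0} \<subset> {v \<in> S. emeasure (dx v) (A v) = 0}"
      and "{v \<in> S. emeasure (dx v) (A2 v) = 0} \<subset> {v \<in> S. emeasure (dx v) (A v) = 0}"
      using w by (auto simp: A1_def A2_def split: if_splits)
    then have "card {v \<in> S. emeasure (dx v) (A1 v) = 0} < card {v \<in> S. emeasure (dx v) (A v) = 0}"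
      and "card {v \<in> S. emeasure (dx v) (A2 v) = 0} < card {v \<in> S. emeasure (dx v) (A v) = 0}"
      using fin by (auto intro: psubset_card_mono)
    then have "adele_rectangle S A1 \<in> sets dxA" "adele_rectangle S A2 \<in> sets dxA"
      using less.hyps A1 A2 by blast+
    moreover have "adele_rectangle S A = adele_rectangle S A1 - adele_rectangle S A2"
      using w(1) by (auto simp: adele_rectangle_def A1_def A2_def split: if_splits)
    ultimately show ?thesis by auto
  qed
qed

lemma space_dxA: "space dxA = carrier adele_ring"
  using dxA_haar by (simp add: haar_measure_def)

text \<open>A point of a rectangle is automatically an adele: it can fail to be integral only at
  places of the finite set \<open>S\<close>.\<close>

lemma rectangle_dxA_iff:
  assumes "places S"
  shows "x \<in> adele_rectangle S A \<longleftrightarrow> x \<in> space dxA \<and> (\<forall>v\<in>S. x v \<in> A v) \<and> (\<forall>v\<in>VQ - S. x v \<in> unit_set v)"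
proof -
  have "finite {p. prime p \<and> x (Prime_place p) \<notin> local_integers p}"
    if "\<forall>p. prime p \<and> Prime_place p \<notin> S \<longrightarrow> x (Prime_place p) \<in> local_integers p"
  proof (rule finite_subset)
    show "{p. prime p \<and> x (Prime_place p) \<notin> local_integers p} \<subseteq> Prime_place -` S" using that by auto
    show "finite (Prime_place -` S)" using assms by (auto intro: finite_vimageI injI simp: places_def)
  qed
  moreover have "(\<forall>v\<in>VQ - S. x v \<in> unit_set v) \<longleftrightarrow>
      (\<forall>p. prime p \<and> Prime_place p \<notin> S \<longrightarrow> x (Prime_place p) \<in> local_integers p)"
  proof (intro iffI allI impI ballI)
    fix p assume "\<forall>v\<in>VQ - S. x v \<in> unit_set v" "prime p \<and> Prime_place p \<notin> S"
    then have "x (Prime_place p) \<in> unit_set (Prime_place p)" using Prime_VQ by blast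
    then show "x (Prime_place p) \<in> local_integers p" by (simp add: unit_set_def)
  next
    fix v assume *: "\<forall>p. prime p \<and> Prime_place p \<notin> S \<longrightarrow> x (Prime_place p) \<in> local_integers p" "v \<in> VQ - S"
    then have "v \<noteq> Inf_place" using assms by (auto simp: places_def)
    then obtain p where "prime p" "v = Prime_place p" using * by (auto simp: VQ_def)
    then show "x v \<in> unit_set v" using * by (simp add: unit_set_def)
  qed
  ultimately show ?thesis
    by (auto simp: adele_rectangle_def space_dxA adele_ring_def)
qed

lemma space_dxA_D:
  assumes "x \<in> space dxA"
  shows "x \<in> extensional VQ" "v \<in> VQ \<Longrightarrow> x v \<in> space (dx v)" "finite {v \<in> VQ. x v \<notin> unit_set v}"
proof -
  show "x \<in> extensional VQ" "v \<in> VQ \<Longrightarrow> x v \<in> space (dx v)"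
    using assms by (auto simp: space_dxA adele_ring_def space_dx PiE_def)
  have "finite (insert Inf_place (Prime_place ` {p. prime p \<and> x (Prime_place p) \<notin> local_integers p}))"
    using assms by (auto simp: space_dxA adele_ring_def)
  then show "finite {v \<in> VQ. x v \<notin> unit_set v}"
    by (rule rev_finite_subset) (auto simp: VQ_def unit_set_def)
qed

text \<open>Every adele lies in the unit sets outside some finite set of places, so a preimage is a
  union of rectangles over the finite \<open>S\<close> containing \<open>v\<close>. There are only
  countably many such \<open>S\<close>.\<close>

lemma measurable_component:
  assumes v: "v \<in> VQ"
  shows "(\<lambda>x. x v) \<in> measurable dxA (dx v)"
proof (rule measurableI)
  show "x v \<in> space (dx v)" if "x \<in> space dxA" for x using space_dxA_D(2)[OF that v] .
  fix A assume A: "A \<in> sets (dx v)"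
  define F where "F = {S. places S \<and> v \<in> S}"
  define R where "R S = adele_rectangle S (\<lambda>w. if w = v then A else space (dx w))" for S
  have "(\<lambda>x. x v) -` A \<inter> space dxA = (\<Union>S\<in>F. R S)"
  proof (intro equalityI subsetI)
    fix x assume x: "x \<in> (\<lambda>x. x v) -` A \<inter> space dxA"
    define S where "S = insert v (insert Inf_place {v \<in> VQ. x v \<notin> unit_set v})"
    have "S \<in> F" using v x space_dxA_D(3)[of x] by (auto simp: F_def S_def places_def Inf_VQ)
    moreover have "x \<in> R S"
      using \<open>S \<in> F\<close> x space_dxA_D[of x] unfolding R_def
      by (subst rectangle_dxA_iff) (auto simp: F_def S_def places_def)
    ultimately show "x \<in> (\<Union>S\<in>F. R S)" by blast
  next
    fix x assume "x \<in> (\<Union>S\<in>F. R S)"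
    then obtain S where "S \<in> F" "x \<in> R S" by blast
    then show "x \<in> (\<lambda>x. x v) -` A \<inter> space dxA"
      by (auto simp: R_def F_def rectangle_dxA_iff)
  qed
  moreover have "countable F"
  proof -
    have "countable VQ" by (simp add: VQ_def)
    then have "countable {S. finite S \<and> S \<subseteq> VQ}" by (rule countable_Collect_finite_subset)
    then show ?thesis by (rule countable_subset[rotated]) (auto simp: F_def places_def)
  qed
  moreover have "R S \<in> sets dxA" if "S \<in> F" for S
    unfolding R_def using that A by (intro rectangle_sets) (auto simp: F_def)
  ultimately show "(\<lambda>x. x v) -` A \<inter> space dxA \<in> sets dxA" by (auto intro: sets.countable_UN'')
qed

section \<open>S-adeles and products over finitely many places\<close>

definition adeles :: "place set \<Rightarrow> (place \<Rightarrow> loc) set" where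
  "adeles S = adele_rectangle S (\<lambda>v. space (dx v))"

text \<open>The shape of \<open>adele_product f\<close> when \<open>f\<close> is the vacuum outside
  \<open>S\<close>: the indicator gathers all the vacuum factors, leaving a finite product.\<close>

definition prod_on :: "place set \<Rightarrow> (place \<Rightarrow> loc \<Rightarrow> complex) \<Rightarrow> (place \<Rightarrow> loc) \<Rightarrow> complex" where
  "prod_on S f x = indicator (adeles S) x * (\<Prod>v\<in>S. f v (x v))"

lemma adeles_sets [measurable]: "places S \<Longrightarrow> adeles S \<in> sets dxA"
  unfolding adeles_def by (rule rectangle_sets) auto

lemma prod_on_measurable:
  assumes S: "places S" and f: "\<And>v. v \<in> S \<Longrightarrow> f v \<in> borel_measurable (dx v)"
  shows "prod_on S f \<in> borel_measurable dxA"
proof -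
  have "(\<lambda>x. f v (x v)) \<in> borel_measurable dxA" if "v \<in> S" for v
    using measurable_compose[OF measurable_component f, of v] S that by (auto simp: places_def)
  then show ?thesis
    unfolding prod_on_def using adeles_sets[OF S] by measurable
qed

text \<open>On the rectangle where all factors are nonzero, the measure is the pullback of the finite
  product measure, whose factors are sigma-finite there by integrability.\<close>

lemma
  assumes S: "places S" and h: "\<And>v. v \<in> S \<Longrightarrow> integrable (dx v) (h v)"
  shows integrable_prod_on: "integrable dxA (prod_on S h)"
    and integral_prod_on: "(\<integral>x. prod_on S h x \<partial>dxA) = (\<Prod>v\<in>S. \<integral>y. h v y \<partial>dx v)"
proof -
  have fin: "finite S" and SVQ: "S \<subseteq> VQ" using S by (auto simp: places_def)
  define E where "E v = {y \<in> space (dx v). h v y \<noteq> 0}" for v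
  have hm [measurable]: "v \<in> S \<Longrightarrow> h v \<in> borel_measurable (dx v)" for v using h by auto
  have E: "v \<in> S \<Longrightarrow> E v \<in> sets (dx v)" for v unfolding E_def by measurable
  \<comment> \<open>\<open>product_sigma_finite\<close> asks for a sigma-finite measure at every
    index, so the places outside \<open>S\<close> receive a trivial one.\<close>
  define N where "N v = (if v \<in> S then density (dx v) (indicator (E v)) else count_space {})" for v
  have setsN: "v \<in> S \<Longrightarrow> sets (N v) = sets (dx v)" for v by (simp add: N_def)
  interpret product_sigma_finite N
  proof (unfold product_sigma_finite_def, rule allI)
    fix v show "sigma_finite_measure (N v)"
      unfolding N_def E_def using sigma_finite_density_support[OF h]
      by (auto intro: sigma_finite_measure_count_space_countable)
  qed
  define R where "R = adele_rectangle S E"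
  have R [measurable]: "R \<in> sets dxA" unfolding R_def by (rule rectangle_sets[OF S E])
  define D where "D = density dxA (indicator R)"
  have rm: "(\<lambda>x. restrict x S) \<in> measurable D (PiM S N)"
  proof (rule measurable_restrict)
    fix v assume v: "v \<in> S"
    have "(\<lambda>x. x v) \<in> measurable dxA (dx v)" using measurable_component v SVQ by blast
    then show "(\<lambda>x. x v) \<in> measurable D (N v)"
      using measurable_cong_sets[of D dxA "N v" "dx v"] setsN[OF v] by (simp add: D_def)
  qed
  \<comment> \<open>Agreement on boxes identifies a finite product of sigma-finite measures. Inside
    \<open>R\<close> the preimage of a box is again a rectangle, whose measure is known.\<close>
  have T: "distr D (PiM S N) (\<lambda>x. restrict x S) = PiM S N"
  proof (rule PiM_eqI[OF fin])
    fix A assume A: "\<And>v. v \<in> S \<Longrightarrow> A v \<in> sets (N v)"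
    have A': "\<And>v. v \<in> S \<Longrightarrow> A v \<in> sets (dx v)" using A setsN by blast
    have P: "PiE S A \<in> sets (PiM S N)" using A fin by (intro sets_PiM_I_finite)
    have "emeasure (distr D (PiM S N) (\<lambda>x. restrict x S)) (PiE S A)
        = emeasure D ((\<lambda>x. restrict x S) -` PiE S A \<inter> space D)"
      by (rule emeasure_distr[OF rm P])
    also have "\<dots> = emeasure dxA (R \<inter> ((\<lambda>x. restrict x S) -` PiE S A \<inter> space D))"
      using measurable_sets[OF rm P] unfolding D_def by (subst emeasure_restricted) auto
    also have "R \<inter> ((\<lambda>x. restrict x S) -` PiE S A \<inter> space D) = adele_rectangle S (\<lambda>v. E v \<inter> A v)"
      unfolding R_def by (auto simp: rectangle_dxA_iff[OF S] D_def PiE_iff)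
    also have "emeasure dxA \<dots> = (\<Prod>v\<in>S. emeasure (dx v) (E v \<inter> A v))"
      using E A' by (intro emeasure_rectangle S) auto
    also have "\<dots> = (\<Prod>v\<in>S. emeasure (N v) (A v))"
      using E A' by (intro prod.cong) (auto simp: N_def emeasure_restricted)
    finally show "emeasure (distr D (PiM S N) (\<lambda>x. restrict x S)) (PiE S A) = (\<Prod>v\<in>S. emeasure (N v) (A v))" .
  qed simp
  have densR: "D = density dxA (\<lambda>x. ennreal (indicator R x))" by (simp add: D_def ennreal_indicator)
  have densE: "N v = density (dx v) (\<lambda>x. ennreal (indicator (E v) x))" if "v \<in> S" for v
    using that by (simp add: N_def ennreal_indicator)
  have restrE: "indicator (E v) y *\<^sub>R h v y = h v y" if "y \<in> space (dx v)" for v y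
    using that by (auto simp: E_def indicator_def)
  have hN: "integrable (N v) (h v)" "(\<integral>y. h v y \<partial>N v) = (\<integral>y. h v y \<partial>dx v)" if v: "v \<in> S" for v
  proof -
    have [measurable]: "E v \<in> sets (dx v)" by (rule E[OF v])
    have "integrable (N v) (h v) \<longleftrightarrow> integrable (dx v) (\<lambda>y. indicator (E v) y *\<^sub>R h v y)"
      unfolding densE[OF v] using hm[OF v] by (intro integrable_density) auto
    also have "\<dots> \<longleftrightarrow> integrable (dx v) (h v)"
      by (rule Bochner_Integration.integrable_cong) (auto simp: restrE)
    finally show "integrable (N v) (h v)" using h[OF v] by simp
    have "(\<integral>y. h v y \<partial>N v) = (\<integral>y. indicator (E v) y *\<^sub>R h v y \<partial>dx v)"
      unfolding densE[OF v] using hm[OF v] by (intro integral_density) auto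
    also have "\<dots> = (\<integral>y. h v y \<partial>dx v)"
      by (rule Bochner_Integration.integral_cong) (auto simp: restrE)
    finally show "(\<integral>y. h v y \<partial>N v) = (\<integral>y. h v y \<partial>dx v)" .
  qed
  define g where "g y = (\<Prod>v\<in>S. h v (y v))" for y :: "place \<Rightarrow> loc"
  have g: "integrable (PiM S N) g"
    unfolding g_def by (rule product_integrable_prod[OF fin hN(1)])
  then have gm: "g \<in> borel_measurable (PiM S N)" by auto
  have grm: "(\<lambda>x. g (restrict x S)) \<in> borel_measurable D" by (rule measurable_compose[OF rm gm])
  then have grA: "(\<lambda>x. g (restrict x S)) \<in> borel_measurable dxA" by (simp add: D_def cong: measurable_cong_sets)
  \<comment> \<open>Off \<open>R\<close> both sides vanish: either the point is no S-adele or some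
    factor \<open>h v\<close> is 0 there.\<close>
  have eq: "prod_on S h x = indicator R x *\<^sub>R g (restrict x S)" if x: "x \<in> space dxA" for x
  proof -
    have g_eq: "g (restrict x S) = (\<Prod>v\<in>S. h v (x v))" by (simp add: g_def)
    show ?thesis
    proof (cases "x \<in> adeles S \<and> (\<forall>v\<in>S. h v (x v) \<noteq> 0)")
      case True
      then have "x \<in> R" using rectangle_dxA_iff[OF S] by (auto simp: R_def E_def adeles_def)
      then show ?thesis using True by (simp add: prod_on_def g_eq)
    next
      case False
      then have "x \<notin> R" using rectangle_dxA_iff[OF S] by (auto simp: R_def E_def adeles_def)
      then show ?thesis using False fin by (auto simp: prod_on_def prod_zero_iff)
    qed
  qed
  have "integrable (distr D (PiM S N) (\<lambda>x. restrict x S)) g" by (simp only: T g)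
  then have "integrable D (\<lambda>x. g (restrict x S))"
    by (simp only: integrable_distr_eq[OF rm gm])
  then have "integrable dxA (\<lambda>x. indicator R x *\<^sub>R g (restrict x S))"
    unfolding densR by (subst (asm) integrable_density) (use grA in auto)
  then show "integrable dxA (prod_on S h)"
    by (subst Bochner_Integration.integrable_cong[OF refl eq])
  have "(\<integral>x. prod_on S h x \<partial>dxA) = (\<integral>x. indicator R x *\<^sub>R g (restrict x S) \<partial>dxA)"
    by (rule Bochner_Integration.integral_cong[OF refl eq])
  also have "\<dots> = (\<integral>x. g (restrict x S) \<partial>D)"
    unfolding densR by (subst integral_density) (use grA in auto)
  also have "\<dots> = (\<integral>y. g y \<partial>distr D (PiM S N) (\<lambda>x. restrict x S))"
    by (rule integral_distr[OF rm gm, symmetric])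
  also have "\<dots> = (\<integral>y. g y \<partial>PiM S N)" by (simp only: T)
  also have "\<dots> = (\<Prod>v\<in>S. \<integral>y. h v y \<partial>N v)"
    unfolding g_def by (rule product_integral_prod[OF fin hN(1)])
  also have "\<dots> = (\<Prod>v\<in>S. \<integral>y. h v y \<partial>dx v)"
    by (simp add: hN(2))
  finally show "(\<integral>x. prod_on S h x \<partial>dxA) = (\<Prod>v\<in>S. \<integral>y. h v y \<partial>dx v)" .
qed

lemma prod_on_mult_cnj:
  "prod_on S f x * cnj (prod_on S g x) = prod_on S (\<lambda>v y. f v y * cnj (g v y)) x"
  by (auto simp: prod_on_def prod.distrib indicator_def)

lemma ip_prod_on:
  assumes S: "places S"
    and f: "\<And>v. v \<in> S \<Longrightarrow> square_integrable (dx v) (f v)"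
    and g: "\<And>v. v \<in> S \<Longrightarrow> square_integrable (dx v) (g v)"
  shows "ip dxA (prod_on S f) (prod_on S g) = (\<Prod>v\<in>S. ip (dx v) (f v) (g v))"
  unfolding ip_def prod_on_mult_cnj using integrable_ip[OF f g]
  by (intro integral_prod_on[OF S])

lemma square_integrable_prod_on:
  assumes S: "places S" and f: "\<And>v. v \<in> S \<Longrightarrow> square_integrable (dx v) (f v)"
  shows "square_integrable dxA (prod_on S f)"
proof -
  have "integrable dxA (\<lambda>x. prod_on S f x * cnj (prod_on S f x))"
    unfolding prod_on_mult_cnj using integrable_ip[OF f f] by (intro integrable_prod_on[OF S])
  then have "integrable dxA (\<lambda>x. cmod (prod_on S f x * cnj (prod_on S f x)))" by (rule integrable_norm)
  moreover have "prod_on S f \<in> borel_measurable dxA"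
    using f by (intro prod_on_measurable[OF S]) (auto simp: square_integrable_def)
  ultimately show ?thesis
    by (simp add: square_integrable_def norm_mult power2_eq_square)
qed

lemma nsq_prod_on:
  assumes S: "places S" and f: "\<And>v. v \<in> S \<Longrightarrow> square_integrable (dx v) (f v)"
  shows "nsq dxA (prod_on S f) = (\<Prod>v\<in>S. nsq (dx v) (f v))"
proof -
  have "complex_of_real (nsq dxA (prod_on S f)) = of_real (\<Prod>v\<in>S. nsq (dx v) (f v))"
    unfolding ip_self[symmetric] using f by (subst ip_prod_on[OF S]) (auto simp: ip_self)
  then show ?thesis using of_real_eq_iff by blast
qed

text \<open>Outside \<open>S\<close> the factors are indicators of unit sets. They are all 1 on the
  S-adeles, and at any other adele one of them is 0.\<close>

lemma adele_product_eq_prod_on: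
  assumes S: "places S" and x: "x \<in> space dxA"
    and f: "\<And>v y. v \<in> VQ - S \<Longrightarrow> y \<in> carrier (local_field v) \<Longrightarrow> f v y = vacuum v y"
  shows "adele_product f x = prod_on S f x"
proof -
  have fin: "finite S" and SVQ: "S \<subseteq> VQ" using S by (auto simp: places_def)
  have fv: "f v (x v) = indicator (unit_set v) (x v)" if "v \<in> VQ - S" for v
    using f[OF that] vacuum_eq[of v "x v"] space_dxA_D(2)[OF x, of v] that by (simp add: space_dx)
  have in_adeles: "x \<in> adeles S \<longleftrightarrow> (\<forall>v\<in>VQ - S. x v \<in> unit_set v)"
    unfolding adeles_def rectangle_dxA_iff[OF S] using x space_dxA_D(2)[OF x] SVQ by auto
  show ?thesis
  proof (cases "x \<in> adeles S")
    case True
    then have "{v \<in> VQ. f v (x v) \<noteq> 1} \<subseteq> S" using fv in_adeles by auto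
    then have "adele_product f x = (\<Prod>v\<in>S. f v (x v))"
      unfolding adele_product_def using fin SVQ by (intro prod.mono_neutral_left) auto
    then show ?thesis using True by (simp add: prod_on_def)
  next
    case False
    then obtain w where w: "w \<in> VQ - S" "x w \<notin> unit_set w" using in_adeles by blast
    have "{v \<in> VQ. f v (x v) \<noteq> 1} \<subseteq> S \<union> {v \<in> VQ. x v \<notin> unit_set v}" using fv by auto
    then have "finite {v \<in> VQ. f v (x v) \<noteq> 1}"
      using space_dxA_D(3)[OF x] fin by (auto intro: finite_subset)
    moreover have "f w (x w) = 0" using fv w by simp
    ultimately have "adele_product f x = 0"
      unfolding adele_product_def using w by (intro prod_zero) auto
    then show ?thesis using False by (simp add: prod_on_def)
  qed
qed

end

section \<open>Totality of the products of local functions\<close>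

text \<open>A bounded conjugate-linear functional that kills a set with dense span is zero.
  \<open>L\<close> acts on functions rather than classes, so each basis class need only contain one
  representative where \<open>L\<close> vanishes; the bound takes care of the others.\<close>

lemma vanishing_on_orthonormal_basis:
  assumes B: "orthonormal_basis (L2 M) B"
    and add: "\<And>f g. square_integrable M f \<Longrightarrow> square_integrable M g \<Longrightarrow> L (\<lambda>x. f x + g x) = L f + L g"
    and scale: "\<And>c f. square_integrable M f \<Longrightarrow> L (\<lambda>x. c * f x) = cnj c * L f"
    and bound: "\<And>f. square_integrable M f \<Longrightarrow> (cmod (L f))\<^sup>2 \<le> C * nsq M f"
    and zero: "\<And>b. b \<in> B \<Longrightarrow> \<exists>g. square_integrable M g \<and> L2_class M g = b \<and> L g = 0"
    and f: "square_integrable M f"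
  shows "L f = (0::complex)"
proof (rule ccontr)
  assume nz: "L f \<noteq> 0"
  have meas: "g \<in> borel_measurable M" if "square_integrable M g" for g
    using that by (simp add: square_integrable_def)
  have span: "\<exists>g. square_integrable M g \<and> L2_class M g = y \<and> L g = 0" if "y \<in> hspan (L2 M) B" for y
    using that
  proof induction
    case zero
    have "L (\<lambda>x. 0) = 0" using bound[OF square_integrable_zero] by (simp add: nsq_def)
    then show ?case by (intro exI[of _ "\<lambda>_. 0"]) (auto simp: L2_def)
  next
    case (step y b c)
    then obtain g h where g: "square_integrable M g" "L2_class M g = y" "L g = 0"
      and h: "square_integrable M h" "L2_class M h = b" "L h = 0" using assms(5) by blast
    have ch: "square_integrable M (\<lambda>x. c * h x)" by (rule square_integrable_scale[OF h(1)])
    have "L2_class M (\<lambda>x. g x + c * h x) = hadd (L2 M) y (hscale (L2 M) c b)"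
      using g h ch by (simp flip: g(2) h(2) add: hscale_L2 hadd_L2 meas)
    moreover have "L (\<lambda>x. g x + c * h x) = 0" using add[OF g(1) ch] scale[OF h(1)] g h by simp
    ultimately show ?case using square_integrable_add[OF g(1) ch] by blast
  qed
  define s where "s = (cmod (L f))\<^sup>2"
  have s: "s > 0" using nz by (simp add: s_def)
  \<comment> \<open>Chosen so that |C| times the square of \<open>\<epsilon>\<close> is below
    \<open>s\<close>. The absolute value and the added 1 cover \<open>C\<close> of any sign and
    \<open>C = 0\<close>.\<close>
  define \<epsilon> where "\<epsilon> = sqrt (s / (\<bar>C\<bar> + 1))"
  have \<epsilon>: "\<epsilon> > 0" using s by (simp add: \<epsilon>_def)
  obtain y where y: "y \<in> hspan (L2 M) B" "hdist (L2 M) (L2_class M f) y < \<epsilon>"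
    using B L2_class_in_hcarrier[OF f] \<epsilon> unfolding orthonormal_basis_def by blast
  obtain g where g: "square_integrable M g" "L2_class M g = y" "L g = 0" using span[OF y(1)] by blast
  have d: "square_integrable M (\<lambda>x. f x - g x)" by (rule square_integrable_diff[OF f g(1)])
  have "L f = L (\<lambda>x. f x - g x)" using add[OF d g(1)] g(3) by simp
  then have "s \<le> C * nsq M (\<lambda>x. f x - g x)" using bound[OF d] by (simp add: s_def)
  also have "\<dots> \<le> \<bar>C\<bar> * nsq M (\<lambda>x. f x - g x)" by (intro mult_right_mono) auto
  also have "\<dots> \<le> \<bar>C\<bar> * (s / (\<bar>C\<bar> + 1))"
    using y(2) hdist_L2[OF f g(1)] g(2) by (intro mult_left_mono) (auto simp: \<epsilon>_def)
  also have "\<dots> < s" using s by (simp add: field_simps)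
  finally show False by simp
qed

lemma square_integrable_indicator:
  assumes "X \<in> sets M" "emeasure M X < \<infinity>"
  shows "square_integrable M (indicator X)" "nsq M (indicator X) = measure M X"
proof -
  have *: "(cmod (indicator X x))\<^sup>2 = indicator X x" for x by (simp add: indicator_def)
  show "square_integrable M (indicator X)"
    using assms by (simp add: square_integrable_def *)
  show "nsq M (indicator X) = measure M X"
    using assms sets.sets_into_space[of X M] by (simp add: nsq_def * Int_absorb2)
qed

text \<open>Test sets are the level sets where the real part of \<open>c * F\<close> is at least
  1/(n+1). They have finite measure by Markov's inequality for the squared modulus, and a function
  positive on such a set with integral 0 over it forces the set to be null.\<close>

lemma AE_zero_of_ip_indicator:
  assumes F: "square_integrable M F"
    and orth: "\<And>X. X \<in> sets M \<Longrightarrow> emeasure M X < \<infinity> \<Longrightarrow> ip M F (indicator X) = 0"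
  shows "AE x in M. F x = 0"
proof -
  have [measurable]: "F \<in> borel_measurable M" using F by (simp add: square_integrable_def)
  have half: "AE x in M. Re (c * F x) \<le> 0" if c: "cmod c = 1" for c
  proof -
    have "AE x in M. Re (c * F x) < 1 / real (Suc n)" for n
    proof -
      define X where "X = {x \<in> space M. Re (c * F x) \<ge> 1 / real (Suc n)}"
      have X: "X \<in> sets M" unfolding X_def by measurable
      have "emeasure M X \<le> emeasure M {x \<in> space M. (cmod (F x))\<^sup>2 \<ge> (1 / real (Suc n))\<^sup>2}"
      proof (rule emeasure_mono)
        show "X \<subseteq> {x \<in> space M. (cmod (F x))\<^sup>2 \<ge> (1 / real (Suc n))\<^sup>2}"
          unfolding X_def using complex_Re_le_cmod[of "c * F x" for x] c
          by (auto intro!: power_mono simp: norm_mult intro: order_trans)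
      qed measurable
      also have "\<dots> \<le> ennreal (1 / (1 / real (Suc n))\<^sup>2 * (\<integral>x. (cmod (F x))\<^sup>2 \<partial>M))"
        using F by (intro integral_Markov_inequality) (auto simp: square_integrable_def)
      finally have fin: "emeasure M X < \<infinity>" by (simp add: le_less_trans)
      note X' = square_integrable_indicator[OF X fin]
      have int: "integrable M (\<lambda>x. c * (F x * cnj (indicator X x)))"
        using integrable_ip[OF F X'(1)] by simp
      have eq: "Re (c * (F x * cnj (indicator X x))) = indicator X x * Re (c * F x)" for x
        by (simp add: indicator_def)
      have "(\<integral>x. indicator X x * Re (c * F x) \<partial>M) = Re (\<integral>x. c * (F x * cnj (indicator X x)) \<partial>M)"
        unfolding eq[symmetric] using int by (rule integral_Re)
      also have "\<dots> = 0" using orth[OF X fin] by (simp add: ip_def)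
      finally have "(\<integral>x. indicator X x * Re (c * F x) \<partial>M) = 0" .
      moreover have "integrable M (\<lambda>x. indicator X x * Re (c * F x))"
        using integrable_Re[OF int] unfolding eq .
      moreover have pos: "x \<in> X \<Longrightarrow> Re (c * F x) > 0" for x
        unfolding X_def by (rule less_le_trans[of 0 "1 / real (Suc n)"]) auto
      then have "AE x in M. 0 \<le> indicator X x * Re (c * F x)"
        by (auto simp: indicator_def less_imp_le)
      ultimately have "AE x in M. indicator X x * Re (c * F x) = 0"
        using integral_nonneg_eq_0_iff_AE by blast
      then show ?thesis
      proof (rule AE_mp, intro AE_I2 impI)
        fix x assume "x \<in> space M" "indicator X x * Re (c * F x) = 0"
        then have "x \<notin> X" using pos[of x] by auto
        then show "Re (c * F x) < 1 / real (Suc n)" using \<open>x \<in> space M\<close> by (auto simp: X_def)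
      qed
    qed
    then have "AE x in M. \<forall>n. Re (c * F x) < 1 / real (Suc n)" by (simp add: AE_all_countable)
    then show ?thesis
    proof eventually_elim
      case (elim x)
      show ?case
      proof (rule ccontr)
        assume "\<not> ?thesis"
        then obtain n where "1 / real (Suc n) < Re (c * F x)"
          by (metis nat_approx_posE not_le)
        then show False using spec[OF elim, of n] by simp
      qed
    qed
  qed
  \<comment> \<open>The factors 1, -1, i and -i bound the real and imaginary parts from both
    sides.\<close>
  have "AE x in M. Re (1 * F x) \<le> 0" "AE x in M. Re (- 1 * F x) \<le> 0"
    "AE x in M. Re (\<i> * F x) \<le> 0" "AE x in M. Re (- \<i> * F x) \<le> 0"
    by (rule half, simp)+
  then show ?thesis
    by eventually_elim (simp add: complex_eq_iff)
qed

section \<open>Basic open sets of the adeles and regularity\<close>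

context adele_measures
begin

text \<open>At a prime the Borel sets are part of \<open>haar_measure\<close>. At infinity the
  measure is an embedded Lebesgue measure, so the metric derived from the ring structure has to be
  identified with the usual distance.\<close>

lemma openin_local_sets:
  assumes v: "v \<in> VQ" and U: "openin (local_topology v) U"
  shows "U \<in> sets (dx v)"
  using v
proof (cases rule: VQ_cases)
  case (2 p)
  then have "sets (dx v) = sigma_sets (carrier (local_field v)) {U. openin (local_topology v) U}"
    using dx_prime[of p] by (simp add: haar_measure_def)
  then show ?thesis using U by auto
next
  case 1
  \<comment> \<open>\<^const>\<open>Metric_space\<close> asks for symmetry on the whole type \<^typ>\<open>loc\<close>; it holds because
    \<open>inv_into\<close> sends the whole right summand to one junk real number.\<close>
  define \<pi> :: "loc \<Rightarrow> real" where "\<pi> = inv_into UNIV Inl"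
  have \<pi>: "\<pi> (Inl a) = a" for a by (simp add: \<pi>_def inv_into_f_f)
  define R where "R = local_field Inf_place"
  have carr: "carrier R = range Inl" by (simp add: R_def image_ring_carrier real_field_def)
  have add: "x \<oplus>\<^bsub>R\<^esub> y = Inl (\<pi> x + \<pi> y)" for x y
    by (simp add: image_ring_def image_group_def monoid.defs real_field_def R_def \<pi>_def)
  have zero: "\<zero>\<^bsub>R\<^esub> = Inl 0" by (simp add: image_ring_zero real_field_def R_def)
  have "\<ominus>\<^bsub>R\<^esub> x = Inl (- \<pi> x)" for x
    \<comment> \<open>Addition is given by \<open>add\<close> on all of \<open>loc\<close>, so the
      description defining the additive inverse has a unique solution even for \<open>x\<close> off
      the carrier.\<close>
    unfolding a_inv_def m_inv_def
    by (rule the_equality) (auto simp: carr add zero \<pi>)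
  then have d: "local_abs Inf_place (x \<ominus>\<^bsub>local_field Inf_place\<^esub> y) = \<bar>\<pi> x - \<pi> y\<bar>" for x y
    
    unfolding R_def[symmetric] by (simp add: a_minus_def add \<pi>)
  interpret Metric_space "range Inl :: loc set" "\<lambda>x y. \<bar>\<pi> x - \<pi> y\<bar>"
    by standard (auto simp: \<pi>)
  have "openin mtopology U" using U 1 by (simp only: local_topology_def carr[unfolded R_def] d)
  then have sub: "U \<subseteq> range Inl" and ball: "x \<in> U \<Longrightarrow> \<exists>r>0. mball x r \<subseteq> U" for x
    by (auto simp: openin_mtopology)
  have "open (Inl -` U :: real set)"
    unfolding open_dist
  proof
    fix a :: real assume "a \<in> Inl -` U"
    then obtain r where r: "r > 0" "mball (Inl a) r \<subseteq> U" using ball by blast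
    have "b \<in> Inl -` U" if "dist b a < r" for b
    proof -
      have "Inl b \<in> mball (Inl a) r" using that by (simp add: \<pi> dist_real_def abs_minus_commute)
      then show ?thesis using r by blast
    qed
    then show "\<exists>e>0. \<forall>b. dist b a < e \<longrightarrow> b \<in> Inl -` U" using r by blast
  qed
  then have "Inl ` (Inl -` U :: real set) \<in> sets (dx Inf_place)"
    unfolding dx_Inf by (intro in_sets_embed_measure) auto
  moreover have "Inl ` (Inl -` U) = U" using sub by auto
  ultimately show ?thesis using 1 by simp
qed

definition basic_opens :: "(place \<Rightarrow> loc) set set" where
  "basic_opens = {\<Pi>\<^sub>E v\<in>VQ. U v | U. (\<forall>v\<in>VQ. openin (local_topology v) (U v)) \<and>
                       finite {p. prime p \<and> U (Prime_place p) \<noteq> local_integers p}}"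

text \<open>Closure under intersection makes the generating family a base, as
  \<open>open_neighbourhood\<close> requires, and lets inclusion-exclusion stay within the
  family.\<close>

lemma basic_opens_Int:
  assumes "G \<in> basic_opens" "H \<in> basic_opens"
  shows "G \<inter> H \<in> basic_opens"
proof -
  obtain U where U: "G = (\<Pi>\<^sub>E v\<in>VQ. U v)" "\<forall>v\<in>VQ. openin (local_topology v) (U v)"
    "finite {p. prime p \<and> U (Prime_place p) \<noteq> local_integers p}"
    using assms(1) by (auto simp: basic_opens_def)
  obtain V where V: "H = (\<Pi>\<^sub>E v\<in>VQ. V v)" "\<forall>v\<in>VQ. openin (local_topology v) (V v)"
    "finite {p. prime p \<and> V (Prime_place p) \<noteq> local_integers p}"
    using assms(2) by (auto simp: basic_opens_def)
  have "finite {p. prime p \<and> U (Prime_place p) \<inter> V (Prime_place p) \<noteq> local_integers p}"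
    by (rule finite_subset[OF _ finite_UnI[OF U(3) V(3)]]) auto
  then show ?thesis
    unfolding basic_opens_def using U V by (auto intro!: exI[of _ "\<lambda>v. U v \<inter> V v"] simp: PiE_Int)
qed

lemma basic_opens_rectangle:
  assumes "G \<in> basic_opens"
  obtains S A where "places S" "\<And>v. v \<in> S \<Longrightarrow> A v \<in> sets (dx v)" "G = adele_rectangle S A"
proof -
  obtain U where U: "G = (\<Pi>\<^sub>E v\<in>VQ. U v)" "\<forall>v\<in>VQ. openin (local_topology v) (U v)"
    "finite {p. prime p \<and> U (Prime_place p) \<noteq> local_integers p}"
    using assms by (auto simp: basic_opens_def)
  define S where "S = insert Inf_place (Prime_place ` {p. prime p \<and> U (Prime_place p) \<noteq> local_integers p})"
  have Uv: "U v \<in> sets (dx v)" if "v \<in> VQ" for v using U that openin_local_sets by blast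
  have S: "places S" using U(3) by (auto simp: places_def S_def VQ_def)
  have off: "v \<in> VQ - S \<Longrightarrow> U v = unit_set v" for v
    by (auto simp: S_def VQ_def unit_set_def)
  have sub: "v \<in> VQ \<Longrightarrow> U v \<subseteq> carrier (local_field v)" for v
    using sets.sets_into_space[OF Uv] by (simp add: space_dx)
  have SVQ: "S \<subseteq> VQ" using S by (simp add: places_def)
  have "G = adele_rectangle S U"
  proof (intro equalityI subsetI)
    fix x assume x: "x \<in> G"
    then have "x (Prime_place p) \<in> local_integers p" if "prime p" "Prime_place p \<notin> S" for p
      using off[of "Prime_place p"] that by (auto simp: U(1) Prime_VQ unit_set_def PiE_def Pi_def)
    moreover have "x v \<in> carrier (local_field v)" if "v \<in> VQ" for v
      using x sub[OF that] that by (auto simp: U(1) PiE_def Pi_def)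
    ultimately show "x \<in> adele_rectangle S U"
      using x SVQ by (auto simp: U(1) adele_rectangle_def PiE_def Pi_def)
  next
    fix x assume x: "x \<in> adele_rectangle S U"
    have "x v \<in> U v" if "v \<in> VQ" for v
    proof (cases "v \<in> S")
      case False
      then show ?thesis using x rectangle_dxA_iff[OF S] off that by auto
    qed (use x in \<open>auto simp: adele_rectangle_def\<close>)
    then show "x \<in> G" using x by (auto simp: U(1) adele_rectangle_def PiE_def)
  qed
  then show ?thesis using that S Uv SVQ by blast
qed

lemma open_neighbourhood:
  assumes "openin adele_topology Q" "x \<in> Q"
  shows "\<exists>G\<in>basic_opens. x \<in> G \<and> G \<subseteq> Q"
proof -
  have "generate_topology_on basic_opens Q"
    using assms(1) by (simp only: adele_topology_def basic_opens_def openin_topology_generated_by_iff)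
  then show ?thesis using assms(2)
  proof (induction arbitrary: x)
    case (Int O1 O2)
    then obtain G1 G2 where "G1 \<in> basic_opens" "x \<in> G1" "G1 \<subseteq> O1" "G2 \<in> basic_opens" "x \<in> G2" "G2 \<subseteq> O2"
      by (meson IntD1 IntD2)
    then show ?case using basic_opens_Int by (intro bexI[of _ "G1 \<inter> G2"]) auto
  next
    case (UN K)
    then show ?case by (meson UnionE Union_upper order_trans)
  qed auto
qed

lemma basic_opens_openin: "G \<in> basic_opens \<Longrightarrow> openin adele_topology G"
  unfolding adele_topology_def basic_opens_def by (rule topology_generated_by_Basis)

lemma basic_opens_sets: "G \<in> basic_opens \<Longrightarrow> G \<in> sets dxA"
  by (metis basic_opens_rectangle rectangle_sets)

lemma openin_adele_sets: "openin adele_topology Q \<Longrightarrow> Q \<in> sets dxA"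
  using dxA_haar by (auto simp: haar_measure_def)

lemma AE_zero_of_ip_prod_on:
  assumes F: "square_integrable dxA F"
    and orth: "\<And>S f. places S \<Longrightarrow> (\<And>v. v \<in> S \<Longrightarrow> square_integrable (dx v) (f v)) \<Longrightarrow> ip dxA F (prod_on S f) = 0"
  shows "AE x in dxA. F x = 0"
proof (rule AE_zero_of_ip_indicator[OF F])
  note ind = square_integrable_indicator
  have rect: "ip dxA F (indicator G) = 0" if G: "G \<in> basic_opens" and fin: "emeasure dxA G < \<infinity>" for G
  \<comment> \<open>Null rectangles are treated apart: they may have a factor of infinite measure
    next to a null one, and its indicator is not square-integrable.\<close>
  proof (cases "emeasure dxA G = 0")
    case True
    then have "nsq dxA (indicator G) = 0"
      using ind(2)[OF basic_opens_sets[OF G] fin] by (simp add: measure_def)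
    then show ?thesis
      using ip_Cauchy_Schwarz[OF F ind(1)[OF basic_opens_sets[OF G] fin]] by simp
  next
    case False
    obtain S A where S: "places S" and A: "\<And>v. v \<in> S \<Longrightarrow> A v \<in> sets (dx v)" and GA: "G = adele_rectangle S A"
      using basic_opens_rectangle[OF G] by blast
    have em: "emeasure dxA G = (\<Prod>v\<in>S. emeasure (dx v) (A v))"
      unfolding GA by (rule emeasure_rectangle[OF S A])
    have finS: "finite S" using S by (simp add: places_def)
    have "emeasure (dx v) (A v) < \<infinity>" if "v \<in> S" for v
    proof -
      have "(\<Prod>v\<in>S. emeasure (dx v) (A v)) \<noteq> \<infinity>" "(\<Prod>v\<in>S. emeasure (dx v) (A v)) \<noteq> 0"
        using fin False em by auto
      then show ?thesis using finS that by (auto simp: ennreal_prod_eq_top prod_zero_iff less_top)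
    qed
    then have sq: "square_integrable (dx v) (indicator (A v))" if "v \<in> S" for v
      using ind(1) A that by blast
    have eq: "indicator G x = prod_on S (\<lambda>v. indicator (A v)) x" if "x \<in> space dxA" for x
    proof -
      have "(\<Prod>v\<in>S. indicator (A v) (x v) :: complex) = (if \<forall>v\<in>S. x v \<in> A v then 1 else 0)"
        using finS by (auto simp: prod_zero_iff indicator_def intro: prod.neutral)
      moreover have "x \<in> G \<longleftrightarrow> x \<in> adeles S \<and> (\<forall>v\<in>S. x v \<in> A v)"
        using space_dxA_D(2)[OF that] S
        by (auto simp: GA adeles_def rectangle_dxA_iff[OF S] places_def)
      ultimately show ?thesis by (auto simp: prod_on_def indicator_def)
    qed
    have "ip dxA F (indicator G) = ip dxA F (prod_on S (\<lambda>v. indicator (A v)))"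
      unfolding ip_def by (intro Bochner_Integration.integral_cong) (auto simp: eq)
    then show ?thesis using orth[OF S sq] by simp
  qed
  have fin_un: "ip dxA F (indicator (\<Union>\<W>)) = 0"
    if "finite \<W>" "\<W> \<subseteq> {G \<in> basic_opens. emeasure dxA G < \<infinity>}" for \<W>
    using that
  \<comment> \<open>Inclusion-exclusion: the indicator of the union is that of \<open>G\<close>,
    plus that of the union of the rest, minus that of the union of all \<open>G \<inter> H\<close>.
    The last family is no subfamily of \<open>\<W>\<close> but is no larger than the rest, hence the
    induction on cardinality.\<close>
  proof (induction "card \<W>" arbitrary: \<W> rule: less_induct)
    case less
    show ?case
    proof (cases "\<W> = {}")
      case True
      then show ?thesis by (simp add: ip_def)
    next
      case False
      then obtain G where G: "G \<in> \<W>" by blast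
      define \<V> where "\<V> = \<W> - {G}"
      define \<V>' where "\<V>' = (\<lambda>H. G \<inter> H) ` \<V>"
      have V: "finite \<V>" "\<V> \<subseteq> {G \<in> basic_opens. emeasure dxA G < \<infinity>}" "card \<V> < card \<W>"
        using less.prems G card_Diff1_less[of \<W> G] by (auto simp: \<V>_def)
      have Gb: "G \<in> basic_opens" "emeasure dxA G < \<infinity>" using less.prems G by auto
      have lt: "emeasure dxA (G \<inter> H) < \<infinity>" for H
      proof -
        have "emeasure dxA (G \<inter> H) \<le> emeasure dxA G" using basic_opens_sets[OF Gb(1)] by (intro emeasure_mono) auto
        then show ?thesis using Gb(2) by (rule le_less_trans)
      qed
      have V': "finite \<V>'" "\<V>' \<subseteq> {G \<in> basic_opens. emeasure dxA G < \<infinity>}" "card \<V>' < card \<W>"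
        using V Gb lt basic_opens_Int card_image_le[OF V(1), of "\<lambda>H. G \<inter> H"] by (auto simp: \<V>'_def)
      have uf: "\<Union>\<U> \<in> sets dxA \<and> emeasure dxA (\<Union>\<U>) < \<infinity>"
        if "finite \<U>" "\<U> \<subseteq> {G \<in> basic_opens. emeasure dxA G < \<infinity>}" for \<U>
      proof
        show "\<Union>\<U> \<in> sets dxA" using that basic_opens_sets by (intro sets.finite_Union) auto
        have "emeasure dxA (\<Union>\<U>) \<le> (\<Sum>G\<in>\<U>. emeasure dxA G)"
          using emeasure_subadditive_finite[of \<U> "\<lambda>G. G" dxA] that basic_opens_sets by auto
        also have "\<dots> < \<infinity>" using that by (auto simp: less_top)
        finally show "emeasure dxA (\<Union>\<U>) < \<infinity>" .
      qed
      have sG: "square_integrable dxA (indicator G)" using ind(1)[OF basic_opens_sets] Gb by blast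
      have sV: "square_integrable dxA (indicator (\<Union>\<V>))" using ind(1) uf[OF V(1,2)] by blast
      have sV': "square_integrable dxA (indicator (\<Union>\<V>'))" using ind(1) uf[OF V'(1,2)] by blast
      have "(indicator (\<Union>\<W>) :: _ \<Rightarrow> complex)
          = (\<lambda>x. (indicator G x + indicator (\<Union>\<V>) x) - indicator (\<Union>\<V>') x)"
        using G by (auto simp: fun_eq_iff indicator_def \<V>_def \<V>'_def)
      then have "ip dxA F (indicator (\<Union>\<W>))
          = ip dxA F (indicator G) + ip dxA F (indicator (\<Union>\<V>)) - ip dxA F (indicator (\<Union>\<V>'))"
        by (simp only: ip_diff_right[OF square_integrable_add[OF sG sV] sV' F] ip_add_right[OF sG sV F])
      then show ?thesis
        using rect[OF Gb] less.hyps[OF V(3,1,2)] less.hyps[OF V'(3,1,2)] by simp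
    qed
  qed
  \<comment> \<open>The difference is the pairing with the indicator of \<open>X - Y\<close>, whose
    squared norm is at most \<open>e\<close>. It is applied to a finite union inside an open set and
    to a Borel set inside an open one.\<close>
  have approx: "(cmod (ip dxA F (indicator X) - ip dxA F (indicator Y)))\<^sup>2 \<le> nsq dxA F * e"
    if "Y \<subseteq> X" "X \<in> sets dxA" "Y \<in> sets dxA" "emeasure dxA X < \<infinity>" "emeasure dxA X \<le> emeasure dxA Y + ennreal e"
      "e > 0" for X Y e
  proof -
    have Yfin: "emeasure dxA Y < \<infinity>" using that emeasure_mono[OF that(1,2)] le_less_trans by blast
    have XY: "X - Y \<in> sets dxA" "emeasure dxA (X - Y) < \<infinity>"
      using that emeasure_mono[of "X - Y" X dxA] by (auto intro: le_less_trans)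
    have "ennreal (measure dxA (X - Y)) + emeasure dxA Y = emeasure dxA X"
    proof -
      have "emeasure dxA (X - Y) + emeasure dxA Y = emeasure dxA X"
        using XY(1) that(1,3) by (subst plus_emeasure) (auto simp: Un_absorb2)
      then show ?thesis
        using XY(2) by (simp add: emeasure_eq_ennreal_measure less_top)
    qed
    then have "emeasure dxA Y + ennreal (measure dxA (X - Y)) \<le> emeasure dxA Y + ennreal e"
      using that(5) by (simp add: add.commute)
    then have le: "measure dxA (X - Y) \<le> e"
      using Yfin that(6) by (auto simp: ennreal_add_left_cancel_le)
    have "(indicator (X - Y) :: _ \<Rightarrow> complex) = (\<lambda>x. indicator X x - indicator Y x)"
      using that(1) by (auto simp: fun_eq_iff indicator_def)
    then have "ip dxA F (indicator X) - ip dxA F (indicator Y) = ip dxA F (indicator (X - Y))"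
      using ip_diff_right[OF ind(1)[OF that(2,4)] ind(1)[OF that(3) Yfin] F] by simp
    then have "(cmod (ip dxA F (indicator X) - ip dxA F (indicator Y)))\<^sup>2 \<le> nsq dxA F * measure dxA (X - Y)"
      using ip_Cauchy_Schwarz[OF F ind(1)[OF XY]] by (simp only: ind(2)[OF XY])
    also have "\<dots> \<le> nsq dxA F * e" by (intro mult_left_mono le) simp
    finally show ?thesis .
  qed
  have zeroI: "z = 0" if "\<And>e. e > 0 \<Longrightarrow> (cmod z)\<^sup>2 \<le> nsq dxA F * e" for z :: complex
  proof (rule ccontr)
    assume "z \<noteq> 0"
    then have s: "(cmod z)\<^sup>2 > 0" by simp
    define e where "e = (cmod z)\<^sup>2 / (nsq dxA F + 1)"
    have pos: "nsq dxA F + 1 > 0" using nsq_nonneg[of dxA F] by linarith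
    have "e > 0" using s pos by (simp add: e_def)
    have "(cmod z)\<^sup>2 = (nsq dxA F + 1) * e" using pos by (simp add: e_def)
    also have "\<dots> > nsq dxA F * e" using \<open>e > 0\<close> by (simp add: algebra_simps)
    finally show False using that[OF \<open>e > 0\<close>] by simp
  qed
  have op: "ip dxA F (indicator Q) = 0" if Q: "openin adele_topology Q" and fin: "emeasure dxA Q < \<infinity>" for Q
  proof (rule zeroI)
    fix e :: real assume e: "e > 0"
    have "emeasure dxA Q = (SUP K\<in>{K. compactin adele_topology K \<and> K \<subseteq> Q}. emeasure dxA K)"
      using dxA_haar Q unfolding haar_measure_def by blast
    then have "\<exists>K\<in>{K. compactin adele_topology K \<and> K \<subseteq> Q}. emeasure dxA Q < emeasure dxA K + ennreal e"
    proof (rule SUP_approx_ennreal[OF e, rotated])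
      show "{K. compactin adele_topology K \<and> K \<subseteq> Q} \<noteq> {}" using compactin_empty by blast
    qed (use fin in simp)
    then obtain K where K: "compactin adele_topology K" "K \<subseteq> Q" "emeasure dxA Q < emeasure dxA K + ennreal e"
      by blast
    \<comment> \<open>A finite union of basic sets inside \<open>Q\<close> that covers
      \<open>K\<close> lies between the two, so its measure is within \<open>e\<close> of that of
      \<open>Q\<close>; its members inherit finite measure from \<open>Q\<close>.\<close>
    define \<G> where "\<G> = {G \<in> basic_opens. G \<subseteq> Q}"
    have "\<exists>\<W>. finite \<W> \<and> \<W> \<subseteq> \<G> \<and> K \<subseteq> \<Union>\<W>"
    proof (rule compactinD[OF K(1)])
      show "K \<subseteq> \<Union>\<G>" using K(2) open_neighbourhood[OF Q] by (fastforce simp: \<G>_def)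
    qed (auto simp: \<G>_def basic_opens_openin)
    then obtain \<W> where W: "finite \<W>" "\<W> \<subseteq> \<G>" "K \<subseteq> \<Union>\<W>" by blast
    have "emeasure dxA G < \<infinity>" if "G \<in> \<W>" for G
      using that W(2) fin emeasure_mono[of G Q dxA] openin_adele_sets[OF Q] le_less_trans
      by (fastforce simp: \<G>_def)
    then have z: "ip dxA F (indicator (\<Union>\<W>)) = 0"
      using W by (intro fin_un) (auto simp: \<G>_def)
    have WS: "\<Union>\<W> \<in> sets dxA" using W basic_opens_sets by (intro sets.finite_Union) (auto simp: \<G>_def)
    have "emeasure dxA K \<le> emeasure dxA (\<Union>\<W>)" by (rule emeasure_mono[OF W(3) WS])
    then have "emeasure dxA Q \<le> emeasure dxA (\<Union>\<W>) + ennreal e"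
      using K(3) by (meson add_right_mono less_imp_le order_trans)
    then have "(cmod (ip dxA F (indicator Q) - ip dxA F (indicator (\<Union>\<W>))))\<^sup>2 \<le> nsq dxA F * e"
      using W(2) openin_adele_sets[OF Q] WS fin e by (intro approx) (auto simp: \<G>_def)
    then show "(cmod (ip dxA F (indicator Q)))\<^sup>2 \<le> nsq dxA F * e" by (simp add: z)
  qed
  fix X assume X: "X \<in> sets dxA" and fin: "emeasure dxA X < \<infinity>"
  show "ip dxA F (indicator X) = 0"
  proof (rule zeroI)
    fix e :: real assume e: "e > 0"
    have "\<exists>Q\<in>{Q. openin adele_topology Q \<and> X \<subseteq> Q}. emeasure dxA Q < emeasure dxA X + ennreal e"
    proof (rule INF_approx_ennreal[OF e])
      show "emeasure dxA X = (INF U\<in>{U. openin adele_topology U \<and> X \<subseteq> U}. emeasure dxA U)"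
        using dxA_haar X unfolding haar_measure_def by blast
    qed (use fin in simp)
    then obtain Q where Q: "openin adele_topology Q" "X \<subseteq> Q" "emeasure dxA Q < emeasure dxA X + ennreal e"
      by blast
    have Ofin: "emeasure dxA Q < \<infinity>" using Q(3) fin by (auto simp: less_top intro: less_trans)
    have "(cmod (ip dxA F (indicator Q) - ip dxA F (indicator X)))\<^sup>2 \<le> nsq dxA F * e"
      using Q X Ofin e openin_adele_sets by (intro approx) auto
    then show "(cmod (ip dxA F (indicator X)))\<^sup>2 \<le> nsq dxA F * e" by (simp add: op[OF Q(1) Ofin])
  qed
qed

end

section \<open>The tensor product basis of the square-integrable functions on the adeles\<close>

locale adele_tensor = adele_measures +
  fixes e :: "place \<Rightarrow> (loc \<Rightarrow> complex) set" and B :: "place \<Rightarrow> (loc \<Rightarrow> complex) set set"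
  assumes e_eq: "e v = L2_class (dx v) (vacuum v)"
    and basis: "v \<in> VQ \<Longrightarrow> orthonormal_basis (L2 (dx v)) (B v)"
    and e_basis: "v \<in> VQ \<Longrightarrow> e v \<in> B v"
begin

abbreviation index :: "(place \<Rightarrow> (loc \<Rightarrow> complex) set) set" where
  "index \<equiv> tensor_index VQ B e"

text \<open>For the class \<open>e v\<close> the function \<open>vacuum v\<close> itself is taken:
  an arbitrary representative could differ from it on a null set at infinitely many places at once,
  and the product over all places would no longer reduce to a finite one.\<close>

definition rep :: "place \<Rightarrow> (loc \<Rightarrow> complex) set \<Rightarrow> loc \<Rightarrow> complex" where
  "rep v b = (if b = e v then vacuum v else L2_rep b)"

definition basis_fun :: "(place \<Rightarrow> (loc \<Rightarrow> complex) set) \<Rightarrow> (place \<Rightarrow> loc) \<Rightarrow> complex" where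
  "basis_fun \<alpha> = adele_product (\<lambda>v. rep v (\<alpha> v))"

lemma square_integrable_vacuum: "v \<in> VQ \<Longrightarrow> square_integrable (dx v) (vacuum v)"
  using square_integrable_indicator(1)[OF unit_set, of v] emeasure_unit_set[of v]
    square_integrable_cong[of "dx v" "vacuum v" "indicator (unit_set v)"]
  by (simp add: vacuum_eq space_dx)

lemma rep:
  assumes v: "v \<in> VQ" and b: "b \<in> B v"
  shows "square_integrable (dx v) (rep v b)" "L2_class (dx v) (rep v b) = b"
proof -
  have "b \<in> hcarrier (L2 (dx v))" using basis[OF v] b by (auto simp: orthonormal_basis_def)
  note b' = square_integrable_L2_rep[OF this]
  show "square_integrable (dx v) (rep v b)" "L2_class (dx v) (rep v b) = b"
    using b' square_integrable_vacuum[OF v] e_eq by (auto simp: rep_def)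
qed

lemma ip_rep:
  assumes v: "v \<in> VQ" and f: "square_integrable (dx v) f" and b: "b \<in> B v"
  shows "ip (dx v) f (rep v b) = hinner (L2 (dx v)) (L2_class (dx v) f) b"
  using hinner_L2[of f "dx v" "rep v b"] f rep[OF v b] by (simp add: square_integrable_def)

lemma ip_rep_rep:
  assumes v: "v \<in> VQ" and "a \<in> B v" "b \<in> B v"
  shows "ip (dx v) (rep v a) (rep v b) = (if a = b then 1 else 0)"
  using ip_rep[OF v rep(1)[OF v assms(2)] assms(3)] rep(2)[OF v assms(2)] basis[OF v] assms
  by (simp add: orthonormal_basis_def)

text \<open>One finite \<open>S\<close> serves two indices at a time. \<open>D\<close> leaves room
  for a place separating them, or for the places where a product function departs from the
  vacuum.\<close>

lemma index_places:
  assumes "\<alpha> \<in> index" "\<beta> \<in> index" "finite D" "D \<subseteq> VQ"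
  obtains S where "places S" "D \<subseteq> S" "\<And>v. v \<in> VQ - S \<Longrightarrow> \<alpha> v = e v \<and> \<beta> v = e v"
proof
  let ?S = "insert Inf_place (D \<union> {v \<in> VQ. \<alpha> v \<noteq> e v} \<union> {v \<in> VQ. \<beta> v \<noteq> e v})"
  show "places ?S" using assms by (auto simp: places_def tensor_index_def Inf_VQ)
qed auto

lemma basis_fun_eq:
  assumes "places S" "\<And>v. v \<in> VQ - S \<Longrightarrow> \<alpha> v = e v" "x \<in> space dxA"
  shows "basis_fun \<alpha> x = prod_on S (\<lambda>v. rep v (\<alpha> v)) x"
  unfolding basis_fun_def using assms by (intro adele_product_eq_prod_on) (auto simp: rep_def)

lemma index_basis: "\<alpha> \<in> index \<Longrightarrow> v \<in> VQ \<Longrightarrow> \<alpha> v \<in> B v"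
  by (auto simp: tensor_index_def)

lemma places_VQ: "places S \<Longrightarrow> v \<in> S \<Longrightarrow> v \<in> VQ"
  by (auto simp: places_def)

lemma ip_basis_fun:
  assumes S: "places S" and \<alpha>: "\<alpha> \<in> index" "\<And>v. v \<in> VQ - S \<Longrightarrow> \<alpha> v = e v"
    and f: "\<And>v. v \<in> VQ \<Longrightarrow> square_integrable (dx v) (f v)"
    and f': "\<And>v y. v \<in> VQ - S \<Longrightarrow> y \<in> carrier (local_field v) \<Longrightarrow> f v y = vacuum v y"
  shows "ip dxA (adele_product f) (basis_fun \<alpha>) = (\<Prod>v\<in>S. ip (dx v) (f v) (rep v (\<alpha> v)))"
proof -
  have "ip dxA (adele_product f) (basis_fun \<alpha>) = ip dxA (prod_on S f) (prod_on S (\<lambda>v. rep v (\<alpha> v)))"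
    using adele_product_eq_prod_on[OF S _ f'] basis_fun_eq[OF S \<alpha>(2)] by (intro ip_cong) auto
  also have "\<dots> = (\<Prod>v\<in>S. ip (dx v) (f v) (rep v (\<alpha> v)))"
    using places_VQ[OF S] by (intro ip_prod_on S f rep index_basis[OF \<alpha>(1)])
  finally show ?thesis .
qed

sublocale orthonormal_family dxA index basis_fun
proof
  fix \<alpha> assume \<alpha>: "\<alpha> \<in> index"
  obtain S where S: "places S" "\<And>v. v \<in> VQ - S \<Longrightarrow> \<alpha> v = e v"
    by (rule index_places[OF \<alpha> \<alpha> finite.emptyI empty_subsetI]) simp
  have "square_integrable dxA (prod_on S (\<lambda>v. rep v (\<alpha> v)))"
    using places_VQ[OF S(1)] by (intro square_integrable_prod_on S rep index_basis[OF \<alpha>])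
  then show "square_integrable dxA (basis_fun \<alpha>)"
    by (subst square_integrable_cong) (rule basis_fun_eq[OF S])
  fix \<beta> assume \<beta>: "\<beta> \<in> index"
  \<comment> \<open>Distinct indices must differ at a place inside the finite set used for the
    computation, so that a factor 0 appears there.\<close>
  have "\<exists>D. finite D \<and> D \<subseteq> VQ \<and> (\<alpha> = \<beta> \<or> (\<exists>v\<in>D. \<alpha> v \<noteq> \<beta> v))"
  proof (cases "\<forall>v\<in>VQ. \<alpha> v = \<beta> v")
    case True
    have "\<alpha> \<in> PiE VQ B" "\<beta> \<in> PiE VQ B" using \<alpha> \<beta> by (auto simp: tensor_index_def)
    then have "\<alpha> = \<beta>" by (rule PiE_ext) (use True in blast)
    then show ?thesis by (intro exI[of _ "{}"]) simp
  next
    case False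
    then obtain v where "v \<in> VQ" "\<alpha> v \<noteq> \<beta> v" by blast
    then show ?thesis by (intro exI[of _ "{v}"]) simp
  qed
  then obtain D where D: "finite D" "D \<subseteq> VQ" "\<alpha> = \<beta> \<or> (\<exists>v\<in>D. \<alpha> v \<noteq> \<beta> v)"
    by blast
  obtain T where T: "places T" "D \<subseteq> T" "\<And>v. v \<in> VQ - T \<Longrightarrow> \<alpha> v = e v \<and> \<beta> v = e v"
    using index_places[OF \<alpha> \<beta> D(1,2)] by blast
  have "ip dxA (basis_fun \<alpha>) (basis_fun \<beta>) = (\<Prod>v\<in>T. ip (dx v) (rep v (\<alpha> v)) (rep v (\<beta> v)))"
    unfolding basis_fun_def[of \<alpha>] using T(1,3) \<alpha> \<beta>
    by (intro ip_basis_fun) (auto simp: rep_def[of _ "e _"] intro!: rep index_basis)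
  also have "\<dots> = (\<Prod>v\<in>T. if \<alpha> v = \<beta> v then 1 else 0)"
    using places_VQ[OF T(1)] by (intro prod.cong refl ip_rep_rep index_basis \<alpha> \<beta>)
  also have "\<dots> = (if \<alpha> = \<beta> then 1 else 0)"
    using D(3) T(1,2) by (auto simp: places_def intro!: prod_zero)
  finally show "ip dxA (basis_fun \<alpha>) (basis_fun \<beta>) = (if \<alpha> = \<beta> then 1 else 0)" .
qed

text \<open>Splitting off the factor at \<open>w\<close> exhibits the dependence on it as linear, so
  the functional in \<open>total\<close> can be varied at a single place.\<close>

lemma prod_on_update:
  assumes "finite S" "w \<in> S"
  shows "prod_on S (f(w := g)) x = prod_on S (f(w := \<lambda>_. 1)) x * g (x w)"
proof -
  have "(\<Prod>v\<in>S - {w}. (f(w := g)) v (x v)) = (\<Prod>v\<in>S - {w}. (f(w := \<lambda>_. 1)) v (x v))"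
    by (rule prod.cong) auto
  then show ?thesis using assms by (simp add: prod_on_def prod.remove[of S w] mult_ac)
qed

text \<open>The factors are released from the bases one place at a time.\<close>

lemma total:
  assumes F: "square_integrable dxA F" and orth: "\<And>\<alpha>. \<alpha> \<in> index \<Longrightarrow> ip dxA F (basis_fun \<alpha>) = 0"
  shows "AE x in dxA. F x = 0"
proof (rule AE_zero_of_ip_prod_on[OF F])
  fix S f assume S: "places S" and f: "\<And>v. v \<in> S \<Longrightarrow> square_integrable (dx v) (f v)"
  have finS: "finite S" using S by (simp add: places_def)
  \<comment> \<open>\<open>T\<close> is the set of places with arbitrary factors; those in
    \<open>S - T\<close> still come from the bases. The case \<open>T = {}\<close> is the hypothesis
    \<open>orth\<close>, the case \<open>T = S\<close> the claim.\<close>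
  have "ip dxA F (prod_on S f) = 0"
    if "T \<subseteq> S" "\<And>v. v \<in> T \<Longrightarrow> square_integrable (dx v) (f v)"
      "\<And>v. v \<in> S - T \<Longrightarrow> f v \<in> rep v ` B v" for T f
    using finite_subset[OF that(1) finS] that
  proof (induction arbitrary: f)
    case empty
    then have "\<forall>v\<in>S. \<exists>b. b \<in> B v \<and> f v = rep v b" by blast
    then obtain b where b: "\<And>v. v \<in> S \<Longrightarrow> b v \<in> B v" "\<And>v. v \<in> S \<Longrightarrow> f v = rep v (b v)" by metis
    define \<alpha> where "\<alpha> = (\<lambda>v\<in>VQ. if v \<in> S then b v else e v)"
    have "\<alpha> \<in> index"
      using b(1) e_basis finS by (auto simp: tensor_index_def \<alpha>_def intro: finite_subset[of _ S])
    have "basis_fun \<alpha> x = prod_on S f x" if "x \<in> space dxA" for x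
    proof -
      have "basis_fun \<alpha> x = prod_on S (\<lambda>v. rep v (\<alpha> v)) x"
        by (rule basis_fun_eq[OF S _ that]) (simp add: \<alpha>_def)
      also have "\<dots> = prod_on S f x"
        unfolding prod_on_def using b(2) places_VQ[OF S]
        by (intro arg_cong2[of _ _ _ _ "(*)"] prod.cong refl) (simp add: \<alpha>_def)
      finally show ?thesis .
    qed
    then have "ip dxA F (prod_on S f) = ip dxA F (basis_fun \<alpha>)" by (intro ip_cong) auto
    then show ?case using orth[OF \<open>\<alpha> \<in> index\<close>] by simp
  next
    case (insert w T)
    have w: "w \<in> S" "w \<in> VQ" using insert.prems(1) places_VQ[OF S] by auto
    have fS: "square_integrable (dx v) (f v)" if v: "v \<in> S" for v
    proof (cases "v \<in> insert w T")
      case False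
      then obtain b where "b \<in> B v" "f v = rep v b" using insert.prems(3)[of v] v by blast
      then show ?thesis using rep(1)[OF places_VQ[OF S v]] by simp
    qed (rule insert.prems(2))
    have sq: "square_integrable dxA (prod_on S (f(w := g)))" if "square_integrable (dx w) g" for g
      using fS that by (intro square_integrable_prod_on[OF S]) auto
    have "ip dxA F (prod_on S (f(w := f w))) = 0"
    \<comment> \<open>\<open>C\<close> comes from Cauchy-Schwarz and the multiplicativity of
      \<open>nsq\<close> over the factors, the one at \<open>w\<close> being left variable.\<close>
    proof (rule vanishing_on_orthonormal_basis[OF basis[OF w(2)],
          where L = "\<lambda>g. ip dxA F (prod_on S (f(w := g)))"
            and C = "nsq dxA F * (\<Prod>v\<in>S - {w}. nsq (dx v) (f v))"])
      show "ip dxA F (prod_on S (f(w := \<lambda>x. g x + h x)))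
          = ip dxA F (prod_on S (f(w := g))) + ip dxA F (prod_on S (f(w := h)))"
        if "square_integrable (dx w) g" "square_integrable (dx w) h" for g h
      proof -
        have "prod_on S (f(w := \<lambda>x. g x + h x)) = (\<lambda>x. prod_on S (f(w := g)) x + prod_on S (f(w := h)) x)"
          by (simp add: fun_eq_iff prod_on_update[OF finS w(1), of f g]
              prod_on_update[OF finS w(1), of f h] prod_on_update[OF finS w(1), of f "\<lambda>x. g x + h x"] distrib_left)
        then show ?thesis using ip_add_right[OF sq sq F] that by simp
      qed
      show "ip dxA F (prod_on S (f(w := \<lambda>x. c * g x))) = cnj c * ip dxA F (prod_on S (f(w := g)))" for c g
      proof -
        have "prod_on S (f(w := \<lambda>x. c * g x)) = (\<lambda>x. c * prod_on S (f(w := g)) x)"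
          by (simp add: fun_eq_iff prod_on_update[OF finS w(1), of f g]
              prod_on_update[OF finS w(1), of f "\<lambda>x. c * g x"] mult_ac)
        then show ?thesis by (simp add: ip_scale_right)
      qed
      show "(cmod (ip dxA F (prod_on S (f(w := g)))))\<^sup>2
          \<le> nsq dxA F * (\<Prod>v\<in>S - {w}. nsq (dx v) (f v)) * nsq (dx w) g"
        if g: "square_integrable (dx w) g" for g
      proof -
        have "nsq dxA (prod_on S (f(w := g))) = (\<Prod>v\<in>S. nsq (dx v) ((f(w := g)) v))"
          using fS g by (intro nsq_prod_on[OF S]) auto
        also have "\<dots> = nsq (dx w) g * (\<Prod>v\<in>S - {w}. nsq (dx v) ((f(w := g)) v))"
          using prod.remove[OF finS w(1), of "\<lambda>v. nsq (dx v) ((f(w := g)) v)"] by simp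
        also have "(\<Prod>v\<in>S - {w}. nsq (dx v) ((f(w := g)) v)) = (\<Prod>v\<in>S - {w}. nsq (dx v) (f v))"
          by (rule prod.cong) auto
        finally show ?thesis using ip_Cauchy_Schwarz[OF F sq[OF g]] by (simp only: mult_ac)
      qed
      show "\<exists>g. square_integrable (dx w) g \<and> L2_class (dx w) g = b \<and> ip dxA F (prod_on S (f(w := g))) = 0"
        if b: "b \<in> B w" for b
      proof (intro exI[of _ "rep w b"] conjI rep[OF w(2) b])
        \<comment> \<open>With a basis representative at \<open>w\<close>, only the places of
          \<open>T\<close> remain arbitrary, so the induction hypothesis applies to the updated
          family.\<close>
        show "ip dxA F (prod_on S (f(w := rep w b))) = 0"
          using insert.prems insert.hyps b by (intro insert.IH) auto
      qed
      show "square_integrable (dx w) (f w)" by (rule fS[OF w(1)])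
    qed
    then show ?case by simp
  qed
  from this[of S f] f show "ip dxA F (prod_on S f) = 0" by simp
qed

text \<open>The coordinates of a product vector are the coefficients of the product function, which
  is the form that \<open>total_imp_unitary_iso\<close> maps back to the function. Both are products
  of local inner products, over different finite sets of places.\<close>

lemma tensor_vector_eq:
  assumes f: "\<And>v. v \<in> VQ \<Longrightarrow> square_integrable (dx v) (f v)"
    and fin: "finite {v \<in> VQ. \<exists>x\<in>carrier (local_field v). f v x \<noteq> vacuum v x}" (is "finite ?D")
  shows "tensor_vector VQ (\<lambda>v. L2 (dx v)) B e (\<lambda>v. L2_class (dx v) (f v))
    = L2_class (count_space index) (\<lambda>\<alpha>. ip dxA (adele_product f) (basis_fun \<alpha>))"
proof -
  have "(\<Prod>v\<in>{v \<in> VQ. L2_class (dx v) (f v) \<noteq> e v \<or> \<alpha> v \<noteq> e v}. hinner (L2 (dx v)) (L2_class (dx v) (f v)) (\<alpha> v))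
      = ip dxA (adele_product f) (basis_fun \<alpha>)" (is "prod ?h ?I = _") if \<alpha>: "\<alpha> \<in> index" for \<alpha>
  proof -
    have D: "?D \<subseteq> VQ" by blast
    obtain S where S: "places S" "?D \<subseteq> S" "\<And>v. v \<in> VQ - S \<Longrightarrow> \<alpha> v = e v"
      by (rule index_places[OF \<alpha> \<alpha> fin D]) simp
    have off: "f v y = vacuum v y" if "v \<in> VQ - S" "y \<in> carrier (local_field v)" for v y
      using S(2) that by blast
    have "L2_class (dx v) (f v) = e v" if v: "v \<in> VQ - S" for v
      unfolding e_eq using f square_integrable_vacuum v off
      by (subst L2_class_eq_iff) (auto simp: square_integrable_def space_dx)
    then have sub: "?I \<subseteq> S" using S(3) by auto
    have "ip dxA (adele_product f) (basis_fun \<alpha>) = (\<Prod>v\<in>S. ip (dx v) (f v) (rep v (\<alpha> v)))"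
      using S(3) off by (intro ip_basis_fun S(1) \<alpha> f)
    also have "\<dots> = (\<Prod>v\<in>S. ?h v)"
      using places_VQ[OF S(1)] by (intro prod.cong refl ip_rep f index_basis \<alpha>)
    also have "\<dots> = prod ?h ?I"
    \<comment> \<open>A surplus place contributes the squared norm of the basis vector
      \<open>e v\<close>, which is 1.\<close>
    proof (rule prod.mono_neutral_right)
      show "\<forall>v\<in>S - ?I. ?h v = 1"
      proof
        fix v assume v: "v \<in> S - ?I"
        then have "v \<in> VQ" "L2_class (dx v) (f v) = e v" "\<alpha> v = e v" using places_VQ[OF S(1)] by auto
        then show "?h v = 1"
          using basis[of v] e_basis[of v] by (simp add: orthonormal_basis_def)
      qed
    qed (use S(1) sub in \<open>auto simp: places_def\<close>)
    finally show ?thesis by simp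
  qed
  then show ?thesis
    unfolding tensor_vector_def by (subst L2_class_eq_iff) (auto simp: AE_count_space)
qed

lemma square_integrable_adele_product:
  assumes f: "\<And>v. v \<in> VQ \<Longrightarrow> square_integrable (dx v) (f v)"
    and fin: "finite {v \<in> VQ. \<exists>x\<in>carrier (local_field v). f v x \<noteq> vacuum v x}" (is "finite ?D")
  shows "square_integrable dxA (adele_product f)"
proof -
  have S: "places (insert Inf_place ?D)" using fin by (auto simp: places_def Inf_VQ)
  have "square_integrable dxA (prod_on (insert Inf_place ?D) f)"
    using places_VQ[OF S] by (intro square_integrable_prod_on[OF S] f)
  moreover have "adele_product f x = prod_on (insert Inf_place ?D) f x" if "x \<in> space dxA" for x
    by (rule adele_product_eq_prod_on[OF S that]) auto
  ultimately show ?thesis using square_integrable_cong by blast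
qed

end

theorem lemma4p3:
  fixes dx :: "place \<Rightarrow> loc measure"
    and dxA :: "(place \<Rightarrow> loc) measure"
    and e :: "place \<Rightarrow> (loc \<Rightarrow> complex) set"
    and B :: "place \<Rightarrow> (loc \<Rightarrow> complex) set set"
  assumes "dx Inf_place = embed_measure lborel Inl"
    and "\<And>p. prime p \<Longrightarrow>
           haar_measure (local_field (Prime_place p)) (local_topology (Prime_place p))
             (dx (Prime_place p))"
    and "\<And>p. prime p \<Longrightarrow> emeasure (dx (Prime_place p)) (local_integers p) = 1"
    and "haar_measure adele_ring adele_topology dxA"
    and "adele_product_measure dx dxA"
    and "\<And>v. e v = L2_class (dx v) (vacuum v)"
    and "\<And>v. v \<in> VQ \<Longrightarrow> orthonormal_basis (L2 (dx v)) (B v)"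
    and "\<And>v. v \<in> VQ \<Longrightarrow> e v \<in> B v"
  shows "\<exists>U. unitary_iso (infinite_tensor VQ B e) (L2 dxA) U \<and>
           (\<forall>f. (\<forall>v\<in>VQ. square_integrable (dx v) (f v)) \<and>
                finite {v \<in> VQ. \<exists>x\<in>carrier (local_field v). f v x \<noteq> vacuum v x} \<longrightarrow>
              U (tensor_vector VQ (\<lambda>v. L2 (dx v)) B e (\<lambda>v. L2_class (dx v) (f v)))
                = L2_class dxA (adele_product f))"
proof -
  interpret adele_tensor dx dxA e B
    using assms by unfold_locales auto
  \<comment> \<open>The second property, taken at \<open>adele_product f\<close>, becomes the
    required formula by \<open>tensor_vector_eq\<close>.\<close>
  obtain U where U: "unitary_iso (L2 (count_space index)) (L2 dxA) U"
    "\<And>g. square_integrable dxA g \<Longrightarrow>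
      U (L2_class (count_space index) (\<lambda>\<alpha>. ip dxA g (basis_fun \<alpha>))) = L2_class dxA g"
    using total_imp_unitary_iso[OF total] by blast
  then show ?thesis
    by (intro exI[of _ U])
      (auto simp: infinite_tensor_def tensor_vector_eq square_integrable_adele_product)
qed

end
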